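(* For every algebraically closed field $k$, there exists a connected adjoint semisimple algebraic group $G$ over $k$ such that the set $C_{\mathrm{Ad}_G}$ of coefficients of the characteristic polynomial of the adjoint representation of $G$ is not a generating set of the $k$-algebra $k[G]^G$ of class functions on $G$.
   Context: For a finite dimensional representation $\varrho\colon G\to\mathbf{GL}(V)$ put $C_\varrho=\{c_{\varrho,i}\in k[G]\mid i=1,\dots,\dim V\}$, where the functions $c_{\varrho,i}$ are defined by $\det(xI-\varrho(g))=\sum_{i=0}^{\dim V}c_{\varrho,i}(g)x^{\dim V-i}$ for every $g\in G$, $x$ being a variable. $\mathrm{Ad}_G$ is the adjoint representation of $G$ on $\mathrm{Lie}\,G$. A semisimple group is adjoint if the character lattice of its maximal torus is generated by the roots. *)

theory Defs
  imports
    "HOL-Library.Function_Algebras"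
    "HOL-Analysis.Abstract_Topology"
    "HOL-Algebra.Solvable_Groups"
    "Jordan_Normal_Form.Char_Poly"
begin

text \<open>
  Algebraic groups are affine and are realised as Zariski closed subgroups \<open>G\<close> of some
  \<open>GL\<^sub>n(k)\<close> (every affine algebraic group is isomorphic to such a subgroup).
  A \<open>k\<close>-valued function on a subset \<open>X\<close> is represented by its extension by zero off \<open>X\<close>, so that
  equality of functions on \<open>X\<close> is equality in HOL, and sums and products are the pointwise ones.
\<close>

definition fun_on :: "'a set \<Rightarrow> ('a \<Rightarrow> 'k::zero) \<Rightarrow> 'a \<Rightarrow> 'k" where
  "fun_on X f = (\<lambda>x. if x \<in> X then f x else 0)"

definition fscale :: "'k::times \<Rightarrow> ('a \<Rightarrow> 'k) \<Rightarrow> 'a \<Rightarrow> 'k" where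
  "fscale c f = (\<lambda>x. c * f x)"

lemma vector_space_fscale: "vector_space (fscale :: 'k::field \<Rightarrow> ('a \<Rightarrow> 'k) \<Rightarrow> 'a \<Rightarrow> 'k)"
  by unfold_locales (auto simp: fscale_def plus_fun_def algebra_simps)

text \<open>The unital \<open>k\<close>-algebra of functions on \<open>X\<close> generated by \<open>S\<close>.\<close>

inductive_set gen_algebra :: "'a set \<Rightarrow> ('a \<Rightarrow> 'k::field) set \<Rightarrow> ('a \<Rightarrow> 'k) set"
  for X :: "'a set" and S :: "('a \<Rightarrow> 'k) set" where
  const: "fun_on X (\<lambda>_. c) \<in> gen_algebra X S"
| incl: "f \<in> S \<Longrightarrow> f \<in> gen_algebra X S"
| add: "f \<in> gen_algebra X S \<Longrightarrow> g \<in> gen_algebra X S \<Longrightarrow> f + g \<in> gen_algebra X S"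
| mult: "f \<in> gen_algebra X S \<Longrightarrow> g \<in> gen_algebra X S \<Longrightarrow> f * g \<in> gen_algebra X S"

section \<open>Linear algebraic groups\<close>

definition GL :: "nat \<Rightarrow> 'k::field mat monoid" where
  "GL n = units_of (ring_mat TYPE('k) n ())"

abbreviation subgrp :: "nat \<Rightarrow> 'k::field mat set \<Rightarrow> 'k mat monoid" where
  "subgrp n G \<equiv> (GL n)\<lparr>carrier := G\<rparr>"

text \<open>\<open>k[X]\<close>: the restrictions to \<open>X\<close> of the elements of
  \<open>k[GL\<^sub>n] = k[x\<^sub>i\<^sub>j, 1/det]\<close>.\<close>

definition regular_functions :: "nat \<Rightarrow> 'k::field mat set \<Rightarrow> ('k mat \<Rightarrow> 'k) set" where
  "regular_functions n X = gen_algebra X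
     ({fun_on X (\<lambda>A. A $$ (i, j)) | i j. i < n \<and> j < n} \<union> {fun_on X (\<lambda>A. inverse (det A))})"

definition zariski :: "nat \<Rightarrow> 'k::field mat topology" where
  "zariski n = topology (\<lambda>U. \<exists>S \<subseteq> regular_functions n (carrier (GL n)).
     U = {A \<in> carrier (GL n). \<exists>f\<in>S. f A \<noteq> 0})"

lemma openin_zariski:
  "openin (zariski n) U \<longleftrightarrow> (\<exists>S \<subseteq> regular_functions n (carrier (GL n)).
     U = {A \<in> carrier (GL n). \<exists>f\<in>S. f A \<noteq> 0})"
proof -
  define R :: "('a mat \<Rightarrow> 'a) set" where "R = regular_functions n (carrier (GL n))"
  define D :: "('a mat \<Rightarrow> 'a) set \<Rightarrow> 'a mat set"
    where "D S = {A \<in> carrier (GL n). \<exists>f\<in>S. f A \<noteq> 0}" for S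
  have mult_R: "f * g \<in> R" if "f \<in> R" "g \<in> R" for f g
    using that unfolding R_def regular_functions_def by (rule gen_algebra.mult)
  have Int: "D S \<inter> D T = D ((\<lambda>(f, g). f * g) ` (S \<times> T))" for S T
    unfolding D_def times_fun_def by auto
  have Un: "(\<Union>S\<in>F. D S) = D (\<Union>F)" for F
    unfolding D_def by auto
  have "istopology (\<lambda>U. \<exists>S\<subseteq>R. U = D S)"
    unfolding istopology_def
  proof (intro conjI allI impI)
    fix U V assume "\<exists>S\<subseteq>R. U = D S" "\<exists>S\<subseteq>R. V = D S"
    then obtain S T where "S \<subseteq> R" "U = D S" "T \<subseteq> R" "V = D T" by (elim exE conjE)
    moreover from this have "(\<lambda>(f, g). f * g) ` (S \<times> T) \<subseteq> R"
      by (auto intro!: mult_R)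
    ultimately show "\<exists>S\<subseteq>R. U \<inter> V = D S"
      using Int by (intro exI[of _ "(\<lambda>(f, g). f * g) ` (S \<times> T)"]) simp
  next
    fix K assume "\<forall>U\<in>K. \<exists>S\<subseteq>R. U = D S"
    then have "K \<subseteq> D ` Pow R" by auto
    then obtain F where "F \<subseteq> Pow R" "K = D ` F" by (rule subset_imageE)
    then show "\<exists>S\<subseteq>R. \<Union>K = D S"
      using Un[of F] by (intro exI[of _ "\<Union>F"]) auto
  qed
  then show ?thesis
    unfolding zariski_def R_def D_def by (simp add: topology_inverse')
qed

definition linear_algebraic_group :: "nat \<Rightarrow> 'k::field mat set \<Rightarrow> bool" where
  "linear_algebraic_group n G \<longleftrightarrow> subgroup G (GL n) \<and> closedin (zariski n) G"

text \<open>Semisimplicity: the radical, i.e. the largest connected closed solvable normal subgroup,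
  is trivial.\<close>

definition semisimple_group :: "nat \<Rightarrow> 'k::field mat set \<Rightarrow> bool" where
  "semisimple_group n G \<longleftrightarrow> linear_algebraic_group n G \<and>
     (\<forall>N. N \<lhd> subgrp n G \<and> closedin (zariski n) N \<and> connectedin (zariski n) N \<and>
          solvable (subgrp n N) \<longrightarrow> N = {\<one>\<^bsub>GL n\<^esub>})"

definition conj_by :: "nat \<Rightarrow> 'k::field mat \<Rightarrow> 'k mat \<Rightarrow> 'k mat" where
  "conj_by n g x = g \<otimes>\<^bsub>GL n\<^esub> x \<otimes>\<^bsub>GL n\<^esub> inv\<^bsub>GL n\<^esub> g"

definition class_functions :: "nat \<Rightarrow> 'k::field mat set \<Rightarrow> ('k mat \<Rightarrow> 'k) set" where
  "class_functions n G = {f \<in> regular_functions n G. \<forall>g\<in>G. \<forall>x\<in>G. f (conj_by n g x) = f x}"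

section \<open>The adjoint representation\<close>

text \<open>\<open>Lie G\<close> as the tangent space at the identity: the \<open>k\<close>-linear maps \<open>\<delta> : k[G] \<rightarrow> k\<close> with
  \<open>\<delta>(f h) = \<delta>(f) h(1) + f(1) \<delta>(h)\<close>, again extended by zero off \<open>k[G]\<close>.\<close>

definition lie_algebra :: "nat \<Rightarrow> 'k::field mat set \<Rightarrow> (('k mat \<Rightarrow> 'k) \<Rightarrow> 'k) set" where
  "lie_algebra n G = {\<delta>.
     (\<forall>f. f \<notin> regular_functions n G \<longrightarrow> \<delta> f = 0) \<and>
     (\<forall>f\<in>regular_functions n G. \<forall>h\<in>regular_functions n G. \<delta> (f + h) = \<delta> f + \<delta> h) \<and>
     (\<forall>c. \<forall>f\<in>regular_functions n G. \<delta> (fscale c f) = c * \<delta> f) \<and>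
     (\<forall>f\<in>regular_functions n G. \<forall>h\<in>regular_functions n G.
        \<delta> (f * h) = \<delta> f * h \<one>\<^bsub>GL n\<^esub> + f \<one>\<^bsub>GL n\<^esub> * \<delta> h)}"

text \<open>\<open>Ad(g)\<close> is the differential at the identity of \<open>x \<mapsto> g x g\<^sup>-\<^sup>1\<close>.\<close>

definition Ad ::
  "nat \<Rightarrow> 'k::field mat set \<Rightarrow> 'k mat \<Rightarrow> (('k mat \<Rightarrow> 'k) \<Rightarrow> 'k) \<Rightarrow> ('k mat \<Rightarrow> 'k) \<Rightarrow> 'k" where
  "Ad n G g \<delta> = fun_on (regular_functions n G) (\<lambda>f. \<delta> (fun_on G (\<lambda>x. f (conj_by n g x))))"

section \<open>Characteristic polynomials of representations\<close>

text \<open>Finite dimensional vector spaces occur as subspaces \<open>V\<close> of a space of \<open>k\<close>-valued functions.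
  The matrix of an endomorphism depends on the basis, its characteristic polynomial does not.\<close>

definition basis_of :: "('a \<Rightarrow> 'k::field) set \<Rightarrow> ('a \<Rightarrow> 'k) list \<Rightarrow> bool" where
  "basis_of V bs \<longleftrightarrow> distinct bs \<and> \<not> Modules.module.dependent fscale (set bs) \<and>
     Modules.module.span fscale (set bs) = V"

definition matrix_in_basis ::
  "('a \<Rightarrow> 'k::field) list \<Rightarrow> (('a \<Rightarrow> 'k) \<Rightarrow> 'a \<Rightarrow> 'k) \<Rightarrow> 'k mat" where
  "matrix_in_basis bs L = mat (length bs) (length bs)
     (\<lambda>(i, j). Modules.module.representation fscale (set bs) (L (bs ! j)) (bs ! i))"

definition char_poly_on :: "('a \<Rightarrow> 'k::field) set \<Rightarrow> (('a \<Rightarrow> 'k) \<Rightarrow> 'a \<Rightarrow> 'k) \<Rightarrow> 'k poly" where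
  "char_poly_on V L = char_poly (matrix_in_basis (SOME bs. basis_of V bs) L)"

definition char_coeffs ::
  "'g set \<Rightarrow> ('a \<Rightarrow> 'k::field) set \<Rightarrow> ('g \<Rightarrow> ('a \<Rightarrow> 'k) \<Rightarrow> 'a \<Rightarrow> 'k) \<Rightarrow> ('g \<Rightarrow> 'k) set" where
  "char_coeffs G V \<rho> =
     {fun_on G (\<lambda>g. poly.coeff (char_poly_on V (\<rho> g)) (Vector_Spaces.vector_space.dim fscale V - i)) | i.
        i \<in> {1..Vector_Spaces.vector_space.dim fscale V}}"

section \<open>Tori, roots, adjoint groups\<close>

definition alg_group_iso ::
  "nat \<Rightarrow> 'k::field mat set \<Rightarrow> nat \<Rightarrow> 'k mat set \<Rightarrow> ('k mat \<Rightarrow> 'k mat) \<Rightarrow> bool" where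
  "alg_group_iso n G m H \<phi> \<longleftrightarrow> \<phi> \<in> iso (subgrp n G) (subgrp m H) \<and>
     (\<forall>f\<in>regular_functions m H. fun_on G (f \<circ> \<phi>) \<in> regular_functions n G) \<and>
     (\<forall>f\<in>regular_functions n G. fun_on H (f \<circ> inv_into G \<phi>) \<in> regular_functions m H)"

definition torus :: "nat \<Rightarrow> 'k::field mat set \<Rightarrow> bool" where
  "torus n T \<longleftrightarrow> linear_algebraic_group n T \<and>
     (\<exists>r \<phi>. alg_group_iso n T r {A \<in> carrier (GL r). diagonal_mat A} \<phi>)"

definition maximal_torus :: "nat \<Rightarrow> 'k::field mat set \<Rightarrow> 'k mat set \<Rightarrow> bool" where
  "maximal_torus n G T \<longleftrightarrow> torus n T \<and> T \<subseteq> G \<and>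
     (\<forall>T'. torus n T' \<and> T \<subseteq> T' \<and> T' \<subseteq> G \<longrightarrow> T' = T)"

definition character_lattice :: "nat \<Rightarrow> 'k::field mat set \<Rightarrow> ('k mat \<Rightarrow> 'k) monoid" where
  "character_lattice n T = \<lparr>
     carrier = {\<chi> \<in> regular_functions n T. (\<forall>s\<in>T. \<chi> s \<noteq> 0) \<and>
        (\<forall>s\<in>T. \<forall>t\<in>T. \<chi> (s \<otimes>\<^bsub>GL n\<^esub> t) = \<chi> s * \<chi> t)},
     monoid.mult = (*),
     one = fun_on T (\<lambda>_. 1)\<rparr>"

definition roots :: "nat \<Rightarrow> 'k::field mat set \<Rightarrow> 'k mat set \<Rightarrow> ('k mat \<Rightarrow> 'k) set" where
  "roots n G T = {\<alpha> \<in> carrier (character_lattice n T). \<alpha> \<noteq> \<one>\<^bsub>character_lattice n T\<^esub> \<and>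
     (\<exists>\<delta>\<in>lie_algebra n G. \<delta> \<noteq> 0 \<and> (\<forall>t\<in>T. Ad n G t \<delta> = fscale (\<alpha> t) \<delta>))}"

text \<open>Maximal tori are conjugate, so the condition does not depend on the choice of \<open>T\<close>.\<close>

definition adjoint_group :: "nat \<Rightarrow> 'k::field mat set \<Rightarrow> bool" where
  "adjoint_group n G \<longleftrightarrow> (\<exists>T. maximal_torus n G T \<and>
     generate (character_lattice n T) (roots n G T) = carrier (character_lattice n T))"

end

theory Submission
  imports Defs
begin

text \<open>
  The group is \<open>G = PGL\<^sub>2 \<times> PGL\<^sub>2\<close>, over every algebraically closed field. The automorphism of \<open>G\<close>
  that swaps the factors induces an automorphism of \<open>Lie G\<close>, which carries \<open>Ad(g, h)\<close> to
  \<open>Ad(h, g)\<close>. The two operators therefore have the same characteristic polynomial, and every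
  element of the algebra generated by its coefficients takes equal values at \<open>(g, h)\<close> and
  \<open>(h, g)\<close>. The class function \<open>(g, h) \<mapsto> tr (Ad g)\<close> does not, so it lies outside that algebra.

  The group is realised in \<open>GL\<^sub>6\<close> by pairs of \<open>3 \<times> 3\<close> blocks, so that the swap becomes conjugation
  by a permutation matrix \<open>P\<close> normalising \<open>G\<close>. The symmetry argument then holds for any normaliser
  element of any matrix group (\<open>char_coeffs_normaliser_invariant\<close>), without a description of
  \<open>Lie G\<close>: \<open>Ad\<close> extends to the normaliser and remains multiplicative there, so that \<open>Ad(P g P\<^sup>-\<^sup>1)\<close>
  and \<open>Ad g\<close> are conjugate.

  The remaining work is to check that \<open>G\<close> has the required properties. Over an algebraically closed
  field \<open>PGL\<^sub>2\<close> is the image of \<open>SL\<^sub>2\<close> in its symmetric square, and this image is cut out by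
  explicit equations in every characteristic (\<open>sym2_eqs_sym2\<close>, \<open>sym2_surj\<close>), so \<open>G\<close> is closed.
  Transvections generate \<open>SL\<^sub>2\<close> (\<open>SL2_induct\<close>), and polynomial curves of transvections link every
  element of \<open>G\<close> to the identity, so \<open>G\<close> is connected.
  A nontrivial normal subgroup contains a transvection of one factor, hence the whole factor; this
  factor lies in its own derived group, so the subgroup is not solvable, and \<open>G\<close> is semisimple.
  For the diagonal torus, the characters are the Laurent monomials in two coordinates because a
  Laurent polynomial without zeros is a monomial; the two coordinates are roots, with root
  vectors the velocities of the two one-parameter groups of transvections, so \<open>G\<close> is adjoint.
\<close>

section \<open>Matrix groups and regular functions\<close>

lemma GL_simps [simp]:
  "monoid.mult (GL n) = (*)" "one (GL n) = 1\<^sub>m n"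
  by (simp_all add: GL_def units_of_def ring_mat_simps)

lemma carrier_GL:
  "carrier (GL n) = {A \<in> carrier_mat n n. \<exists>B \<in> carrier_mat n n. B * A = 1\<^sub>m n \<and> A * B = 1\<^sub>m n}"
  by (simp add: GL_def units_of_def Units_def ring_mat_simps)

lemma group_GL: "group (GL n)"
  unfolding GL_def
  using ring.is_monoid[OF ring_mat] by (rule monoid.units_group)

lemma GL_I:
  assumes "A \<in> carrier_mat n n" "B \<in> carrier_mat n n" "A * B = 1\<^sub>m n" "B * A = 1\<^sub>m n"
  shows "A \<in> carrier (GL n)" "inv\<^bsub>GL n\<^esub> A = B"
proof -
  show A: "A \<in> carrier (GL n)" using assms by (auto simp: carrier_GL)
  have B: "B \<in> carrier (GL n)" using assms by (auto simp: carrier_GL)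
  show "inv\<^bsub>GL n\<^esub> A = B"
    by (rule group.inv_equality[OF group_GL]) (use A B assms in auto)
qed

lemma GL_carrier_mat: "A \<in> carrier (GL n) \<Longrightarrow> A \<in> carrier_mat n n"
  by (simp add: carrier_GL)

lemma GL_inv:
  assumes "A \<in> carrier (GL n)"
  shows "inv\<^bsub>GL n\<^esub> A \<in> carrier_mat n n" "A * inv\<^bsub>GL n\<^esub> A = 1\<^sub>m n" "inv\<^bsub>GL n\<^esub> A * A = 1\<^sub>m n"
  using group.inv_closed[OF group_GL assms] group.r_inv[OF group_GL assms]
    group.l_inv[OF group_GL assms] by (auto simp: GL_carrier_mat)

lemma GL_det_nz:
  assumes "A \<in> carrier (GL n)" shows "det A \<noteq> 0"
proof
  assume "det A = 0"
  then have "det (A * inv\<^bsub>GL n\<^esub> A) = 0"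
    using det_mult[OF GL_carrier_mat[OF assms] GL_inv(1)[OF assms]] by simp
  then show False using GL_inv(2)[OF assms] by simp
qed

lemma fun_on_apply: "x \<in> X \<Longrightarrow> fun_on X f x = f x"
  by (simp add: fun_on_def)

lemma fun_on_cong: "(\<And>x. x \<in> X \<Longrightarrow> f x = g x) \<Longrightarrow> fun_on X f = fun_on X g"
  by (auto simp: fun_on_def)

lemma gen_algebra_fun_on:
  assumes "f \<in> gen_algebra X S" "\<And>g. g \<in> S \<Longrightarrow> fun_on X g = g"
  shows "fun_on X f = f"
  using assms(1)
proof induction
  case (incl f) then show ?case by (rule assms(2))
next
  case (add f g)
  then show ?case by (metis (no_types, lifting) add_0 fun_on_def plus_fun_apply ext)
next
  case (mult f g)
  then show ?case by (metis (no_types, lifting) mult_zero_left fun_on_def times_fun_apply ext)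
qed (auto simp: fun_on_def)

lemma regular_fun_on: "f \<in> regular_functions n X \<Longrightarrow> fun_on X f = f"
  unfolding regular_functions_def by (erule gen_algebra_fun_on) (auto simp: fun_on_def)

lemma reg_const: "fun_on X (\<lambda>_. c) \<in> regular_functions n X"
  unfolding regular_functions_def by (rule gen_algebra.const)

lemma reg_entry: "i < n \<Longrightarrow> j < n \<Longrightarrow> fun_on X (\<lambda>A. A $$ (i, j)) \<in> regular_functions n X"
  unfolding regular_functions_def by (rule gen_algebra.incl) auto

lemma reg_inv_det: "fun_on X (\<lambda>A. inverse (det A)) \<in> regular_functions n X"
  unfolding regular_functions_def by (rule gen_algebra.incl) auto

lemma reg_add:
  assumes "fun_on X f \<in> regular_functions n X" "fun_on X g \<in> regular_functions n X"
  shows "fun_on X (\<lambda>A. f A + g A) \<in> regular_functions n X"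
proof -
  have "fun_on X f + fun_on X g \<in> regular_functions n X"
    using assms unfolding regular_functions_def by (rule gen_algebra.add)
  moreover have "fun_on X f + fun_on X g = fun_on X (\<lambda>A. f A + g A)"
    by (auto simp: fun_on_def)
  ultimately show ?thesis by simp
qed

lemma reg_mult:
  assumes "fun_on X f \<in> regular_functions n X" "fun_on X g \<in> regular_functions n X"
  shows "fun_on X (\<lambda>A. f A * g A) \<in> regular_functions n X"
proof -
  have "fun_on X f * fun_on X g \<in> regular_functions n X"
    using assms unfolding regular_functions_def by (rule gen_algebra.mult)
  moreover have "fun_on X f * fun_on X g = fun_on X (\<lambda>A. f A * g A)"
    by (auto simp: fun_on_def)
  ultimately show ?thesis by simp
qed

lemma reg_diff:
  assumes "fun_on X f \<in> regular_functions n X" "fun_on X g \<in> regular_functions n X"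
  shows "fun_on X (\<lambda>A. f A - g A) \<in> regular_functions n X"
  using reg_add[OF assms(1) reg_mult[OF reg_const[of X "-1"] assms(2)]] by simp

lemma reg_power:
  assumes "fun_on X f \<in> regular_functions n X"
  shows "fun_on X (\<lambda>A. f A ^ m) \<in> regular_functions n X"
  by (induction m) (auto intro: reg_const reg_mult assms)

lemma reg_sum:
  assumes "\<And>i. i \<in> I \<Longrightarrow> fun_on X (f i) \<in> regular_functions n X"
  shows "fun_on X (\<lambda>A. \<Sum>i\<in>I. f i A) \<in> regular_functions n X"
  using assms by (induction I rule: infinite_finite_induct) (auto intro: reg_const reg_add)

lemmas reg_intros = reg_const reg_entry reg_inv_det reg_add reg_mult reg_diff reg_power reg_sum

lemma regular_induct [consumes 1, case_names const entry inv_det add mult]: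
  assumes "f \<in> regular_functions n X"
    and "\<And>c. P (fun_on X (\<lambda>_. c))"
    and "\<And>i j. i < n \<Longrightarrow> j < n \<Longrightarrow> P (fun_on X (\<lambda>A. A $$ (i, j)))"
    and "P (fun_on X (\<lambda>A. inverse (det A)))"
    and "\<And>f g. f \<in> regular_functions n X \<Longrightarrow> g \<in> regular_functions n X \<Longrightarrow> P f \<Longrightarrow> P g \<Longrightarrow> P (f + g)"
    and "\<And>f g. f \<in> regular_functions n X \<Longrightarrow> g \<in> regular_functions n X \<Longrightarrow> P f \<Longrightarrow> P g \<Longrightarrow> P (f * g)"
  shows "P f"
  using assms(1) unfolding regular_functions_def
proof induction
  case (incl f)
  then show ?case using assms(3,4) by auto
next
  case (add f g)
  show ?case by (rule assms(5)) (use add in \<open>simp_all only: regular_functions_def\<close>)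
next
  case (mult f g)
  show ?case by (rule assms(6)) (use mult in \<open>simp_all only: regular_functions_def\<close>)
qed (rule assms(2))

text \<open>
  The source of all regularity statements below: conjugations, and the isomorphism between the torus
  and the diagonal group, are given entrywise.
\<close>

lemma regular_comp:
  assumes f: "f \<in> regular_functions m Y" and \<psi>: "\<And>x. x \<in> X \<Longrightarrow> \<psi> x \<in> Y"
    and ent: "\<And>i j. i < m \<Longrightarrow> j < m \<Longrightarrow> fun_on X (\<lambda>x. \<psi> x $$ (i, j)) \<in> regular_functions n X"
    and det: "fun_on X (\<lambda>x. inverse (det (\<psi> x))) \<in> regular_functions n X"
  shows "fun_on X (\<lambda>x. f (\<psi> x)) \<in> regular_functions n X"
  using f
proof (induction rule: regular_induct)
  case (const c)
  have "fun_on X (\<lambda>x. fun_on Y (\<lambda>_. c) (\<psi> x)) = fun_on X (\<lambda>_. c)"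
    by (rule fun_on_cong) (simp add: fun_on_apply \<psi>)
  then show ?case by (simp add: reg_const)
next
  case (entry i j)
  have "fun_on X (\<lambda>x. fun_on Y (\<lambda>A. A $$ (i, j)) (\<psi> x)) = fun_on X (\<lambda>x. \<psi> x $$ (i, j))"
    by (rule fun_on_cong) (simp add: fun_on_apply \<psi>)
  then show ?case by (simp add: ent entry)
next
  case inv_det
  have "fun_on X (\<lambda>x. fun_on Y (\<lambda>A. inverse (det A)) (\<psi> x)) = fun_on X (\<lambda>x. inverse (det (\<psi> x)))"
    by (rule fun_on_cong) (simp add: fun_on_apply \<psi>)
  then show ?case by (simp add: det)
qed (auto intro: reg_add reg_mult)

lemma topspace_zariski [simp]: "topspace (zariski n) = (carrier (GL n) :: 'k::field mat set)"
proof
  have "openin (zariski n) (carrier (GL n) :: 'k mat set)"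
    unfolding openin_zariski
    by (rule exI[of _ "{fun_on (carrier (GL n)) (\<lambda>_. 1)}"]) (use reg_const in \<open>auto simp: fun_on_apply\<close>)
  then show "(carrier (GL n) :: 'k mat set) \<subseteq> topspace (zariski n)" by (rule openin_subset)
  show "topspace (zariski n) \<subseteq> (carrier (GL n) :: 'k mat set)"
    unfolding topspace_def by (auto simp: openin_zariski)
qed

text \<open>
  The largest family of equations for \<open>C\<close> consists of all the functions that vanish on it, so each
  closed set below comes down to specialising the hypothesis to finitely many of them.
\<close>

lemma closedin_zariskiI:
  fixes C :: "'k::field mat set"
  assumes sub: "C \<subseteq> carrier (GL n)"
    and C: "\<And>A. A \<in> carrier (GL n) \<Longrightarrow>
      (\<And>f. fun_on (carrier (GL n)) f \<in> regular_functions n (carrier (GL n)) \<Longrightarrow> (\<And>x. x \<in> C \<Longrightarrow> f x = 0) \<Longrightarrow> f A = 0)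
      \<Longrightarrow> A \<in> C"
  shows "closedin (zariski n) C"
proof -
  let ?R = "regular_functions n (carrier (GL n)) :: ('k mat \<Rightarrow> 'k) set"
  define S where "S = {f \<in> ?R. \<forall>x\<in>C. f x = 0}"
  have 1: "\<exists>f\<in>S. f A \<noteq> 0" if A: "A \<in> carrier (GL n)" "A \<notin> C" for A
  proof -
    from A C obtain f where "fun_on (carrier (GL n)) f \<in> ?R" "\<And>x. x \<in> C \<Longrightarrow> f x = 0" "f A \<noteq> 0"
      by blast
    with A sub show ?thesis unfolding S_def
      by (auto intro!: bexI[of _ "fun_on (carrier (GL n)) f"] simp: fun_on_def)
  qed
  have 2: "f A = 0" if "f \<in> S" "A \<in> C" for f A
    using that by (simp add: S_def)
  have eq: "carrier (GL n) - C = {A \<in> carrier (GL n). \<exists>f\<in>S. f A \<noteq> 0}"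
  proof (rule subset_antisym; rule subsetI)
    show "A \<in> {A \<in> carrier (GL n). \<exists>f\<in>S. f A \<noteq> 0}" if "A \<in> carrier (GL n) - C" for A
      using that 1[of A] by simp
    show "A \<in> carrier (GL n) - C" if "A \<in> {A \<in> carrier (GL n). \<exists>f\<in>S. f A \<noteq> 0}" for A
      using that 2[of _ A] by force
  qed
  have "S \<subseteq> ?R" by (simp add: S_def)
  with eq have "openin (zariski n) (carrier (GL n) - C)"
    unfolding openin_zariski by - (rule exI[of _ S], rule conjI)
  then show ?thesis using sub by (simp add: closedin_def)
qed

section \<open>Polynomial curves\<close>

lemma infinite_field: "infinite (UNIV :: 'k::alg_closed_field set)"
proof
  assume fin: "finite (UNIV :: 'k set)"
  \<comment> \<open>\<open>1 + (\<Prod>a. x - a)\<close> would be a nonconstant polynomial without roots.\<close>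
  define p :: "'k poly" where "p = (\<Prod>a\<in>UNIV. [:- a, 1:])"
  have 1: "poly (1 + p) x = 1" for x
    unfolding p_def using fin by (simp add: poly_prod prod_zero_iff)
  have "degree p = card (UNIV :: 'k set)"
    unfolding p_def by (subst degree_prod_eq_sum_degree) auto
  moreover have "card (UNIV :: 'k set) > 0" using fin by (simp add: card_gt_0_iff)
  ultimately have "degree (1 + p) > 0" by (simp add: degree_add_eq_right)
  then show False using alg_closed_imp_poly_has_root[of "1 + p"] 1 by auto
qed

lemma poly_fun_eqD:
  fixes p q :: "'k::alg_closed_field poly"
  assumes "\<And>x. x \<notin> F \<Longrightarrow> poly p x = poly q x" "finite F" shows "p = q"
proof (rule ccontr)
  assume "p \<noteq> q"
  then have "finite {x. poly (p - q) x = 0}" by (intro poly_roots_finite) simp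
  moreover have "- F \<subseteq> {x. poly (p - q) x = 0}" using assms(1) by auto
  ultimately have "finite (- F)" by (rule finite_subset[rotated])
  with assms(2) have "finite (UNIV :: 'k set)" by (metis finite_compl)
  with infinite_field[where 'k = 'k] show False by simp
qed

text \<open>
  Over an infinite field such a function determines its polynomial (\<open>poly_fun_eqD\<close>), which makes
  coefficients, and thus derivatives at zero, meaningful in every characteristic.
\<close>

definition poly_fun :: "('k::field \<Rightarrow> 'k) \<Rightarrow> bool" where
  "poly_fun h \<longleftrightarrow> (\<exists>p. \<forall>x. h x = poly p x)"

lemma poly_fun_intros:
  "poly_fun (\<lambda>x. x)" "poly_fun (\<lambda>_. c)"
  "poly_fun f \<Longrightarrow> poly_fun g \<Longrightarrow> poly_fun (\<lambda>x. f x + g x)"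
  "poly_fun f \<Longrightarrow> poly_fun g \<Longrightarrow> poly_fun (\<lambda>x. f x * g x)"
proof -
  show "poly_fun (\<lambda>x. x)" unfolding poly_fun_def by (rule exI[of _ "[:0,1:]"]) simp
  show "poly_fun (\<lambda>_. c)" unfolding poly_fun_def by (rule exI[of _ "[:c:]"]) simp
  show "poly_fun f \<Longrightarrow> poly_fun g \<Longrightarrow> poly_fun (\<lambda>x. f x + g x)"
    unfolding poly_fun_def by (metis poly_add)
  show "poly_fun f \<Longrightarrow> poly_fun g \<Longrightarrow> poly_fun (\<lambda>x. f x * g x)"
    unfolding poly_fun_def by (metis poly_mult)
qed

lemma poly_fun_sum: "(\<And>i. i \<in> I \<Longrightarrow> poly_fun (f i)) \<Longrightarrow> poly_fun (\<lambda>x. \<Sum>i\<in>I. f i x)"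
  by (induction I rule: infinite_finite_induct) (auto intro: poly_fun_intros)

text \<open>
  The determinant is fixed to be one so that the regular function \<open>1/det\<close> also pulls back to a
  polynomial along the curve.
\<close>

definition poly_curve :: "nat \<Rightarrow> ('k::field \<Rightarrow> 'k mat) \<Rightarrow> bool" where
  "poly_curve n c \<longleftrightarrow> (\<forall>i<n. \<forall>j<n. poly_fun (\<lambda>s. c s $$ (i, j))) \<and> (\<forall>s. det (c s) = 1)"

lemma poly_fun_regular:
  assumes f: "f \<in> regular_functions n X" and c: "poly_curve n c" "\<And>s. c s \<in> X"
  shows "poly_fun (\<lambda>s. f (c s))"
  using f
proof (induction rule: regular_induct)
  case (const d) then show ?case using c by (simp add: fun_on_def poly_fun_intros)
next
  case (entry i j) then show ?case using c by (simp add: fun_on_def poly_curve_def)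
next
  case inv_det then show ?case using c by (simp add: fun_on_def poly_curve_def poly_fun_intros)
qed (simp_all add: poly_fun_intros)

text \<open>
  The affine line is irreducible: two nonempty open sets contain the nonzero loci of two nonzero
  polynomials, and these meet.
\<close>

lemma connectedin_poly_curve:
  fixes c :: "'k::alg_closed_field \<Rightarrow> 'k mat"
  assumes c: "poly_curve n c" "\<And>s. c s \<in> carrier (GL n)"
  shows "connectedin (zariski n) (range c)"
  unfolding connectedin
proof (intro conjI notI)
  show "range c \<subseteq> topspace (zariski n)" using c by auto
  assume "\<exists>E1 E2. openin (zariski n) E1 \<and> openin (zariski n) E2 \<and> range c \<subseteq> E1 \<union> E2 \<and>
    E1 \<inter> E2 \<inter> range c = {} \<and> E1 \<inter> range c \<noteq> {} \<and> E2 \<inter> range c \<noteq> {}"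
  then obtain E1 E2 where E: "openin (zariski n) E1" "openin (zariski n) E2"
    "E1 \<inter> E2 \<inter> range c = {}" "E1 \<inter> range c \<noteq> {}" "E2 \<inter> range c \<noteq> {}" by blast
  have *: "\<exists>p. p \<noteq> 0 \<and> (\<forall>s. poly p s \<noteq> 0 \<longrightarrow> c s \<in> E)"
    if E: "openin (zariski n) E" "E \<inter> range c \<noteq> {}" for E
  proof -
    from E(1) obtain S where S: "S \<subseteq> regular_functions n (carrier (GL n))"
      "E = {A \<in> carrier (GL n). \<exists>f\<in>S. f A \<noteq> 0}" unfolding openin_zariski by blast
    with E(2) obtain f s0 where f: "f \<in> S" "f (c s0) \<noteq> 0" by auto
    with S(1) have "poly_fun (\<lambda>s. f (c s))" by (intro poly_fun_regular[OF _ c]) auto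
    then obtain p where p: "\<forall>s. f (c s) = poly p s" unfolding poly_fun_def by blast
    show ?thesis
    proof (intro exI[of _ p] conjI allI impI)
      show "p \<noteq> 0" using f p by auto
      show "c s \<in> E" if "poly p s \<noteq> 0" for s
        using that p f(1) c(2) unfolding S(2) by (metis (mono_tags, lifting) mem_Collect_eq)
    qed
  qed
  from *[OF E(1,4)] *[OF E(2,5)] obtain p q where
    pq: "p \<noteq> 0" "\<forall>s. poly p s \<noteq> 0 \<longrightarrow> c s \<in> E1" "q \<noteq> 0" "\<forall>s. poly q s \<noteq> 0 \<longrightarrow> c s \<in> E2" by blast
  have "p * q \<noteq> 0" using pq by simp
  then obtain s where "poly (p * q) s \<noteq> 0" using poly_fun_eqD[of "{}" "p * q" 0] by auto
  then have "c s \<in> E1 \<inter> E2 \<inter> range c" using pq by auto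
  with E(3) show False by simp
qed

text \<open>
  Over an algebraically closed field a polynomial whose only possible root is zero is a monomial.
\<close>

lemma nonvanishing_laurent_is_monomial:
  fixes h :: "'k::alg_closed_field \<Rightarrow> 'k"
  assumes p: "\<And>s. s \<noteq> 0 \<Longrightarrow> h s * s ^ m = poly p s"
    and nz: "\<And>s. s \<noteq> 0 \<Longrightarrow> h s \<noteq> 0" and h1: "h 1 = 1"
  shows "\<exists>i::int. \<forall>s. s \<noteq> 0 \<longrightarrow> h s = s powi i"
proof -
  have p0: "p \<noteq> 0" using p[of 1] h1 by auto
  obtain q where q: "p = [:- 0, 1:] ^ order 0 p * q" "\<not> [:- 0, 1:] dvd q"
    using order_decomp[OF p0] by blast
  have "poly q s \<noteq> 0" for s
  proof (cases "s = 0")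
    case True
    with q(2) show ?thesis by (simp add: poly_eq_0_iff_dvd)
  next
    case False
    have "poly p s = poly ([:- 0, 1:] ^ order 0 p * q) s" using q(1) by simp
    with False p[of s] nz[of s] show ?thesis by auto
  qed
  then have "degree q = 0" using alg_closed_imp_poly_has_root[of q] by auto
  then obtain c where c: "q = [:c:]" by (rule degree_eq_zeroE)
  have ps: "poly p s = s ^ order 0 p * c" for s
    by (subst q(1)) (simp add: c)
  have "c = 1" using ps[of 1] p[of 1] h1 by simp
  show ?thesis
  proof (intro exI[of _ "int (order 0 p) - int m"] allI impI)
    fix s :: 'k assume "s \<noteq> 0"
    with ps[of s] p[of s] \<open>c = 1\<close> show "h s = s powi (int (order 0 p) - int m)"
      by (simp add: power_int_diff field_simps)
  qed
qed

section \<open>Characteristic polynomials on function spaces\<close>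

interpretation FS: vector_space "fscale :: 'k::field \<Rightarrow> ('a \<Rightarrow> 'k) \<Rightarrow> 'a \<Rightarrow> 'k"
  by (rule vector_space_fscale)

definition linear_endo :: "('a \<Rightarrow> 'k::field) set \<Rightarrow> (('a \<Rightarrow> 'k) \<Rightarrow> 'a \<Rightarrow> 'k) \<Rightarrow> bool" where
  "linear_endo V L \<longleftrightarrow> (\<forall>v\<in>V. L v \<in> V) \<and> (\<forall>v\<in>V. \<forall>w\<in>V. L (v + w) = L v + L w) \<and>
     (\<forall>c. \<forall>v\<in>V. L (fscale c v) = fscale c (L v))"

lemma linear_endo_sum:
  assumes L: "linear_endo V L" and V: "FS.subspace V" and v: "\<And>i. i \<in> I \<Longrightarrow> v i \<in> V"
  shows "L (\<Sum>i\<in>I. fscale (c i) (v i)) = (\<Sum>i\<in>I. fscale (c i) (L (v i)))"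
proof -
  have "L (fscale 0 0) = fscale 0 (L 0)"
    using L FS.subspace_0[OF V] unfolding linear_endo_def by metis
  then have L0: "L 0 = 0" by (simp only: FS.scale_zero_left)
  show ?thesis
    using v
  proof (induction I rule: infinite_finite_induct)
    case (insert x F)
    have x: "v x \<in> V" using insert.prems by simp
    have s: "(\<Sum>i\<in>F. fscale (c i) (v i)) \<in> V"
      using insert.prems V by (intro FS.subspace_sum FS.subspace_scale) simp_all
    have "L (fscale (c x) (v x) + (\<Sum>i\<in>F. fscale (c i) (v i))) =
        L (fscale (c x) (v x)) + L (\<Sum>i\<in>F. fscale (c i) (v i))"
      using L s FS.subspace_scale[OF V x] unfolding linear_endo_def by metis
    also have "L (fscale (c x) (v x)) = fscale (c x) (L (v x))"
      using L x unfolding linear_endo_def by metis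
    also have "L (\<Sum>i\<in>F. fscale (c i) (v i)) = (\<Sum>i\<in>F. fscale (c i) (L (v i)))"
      using insert.IH insert.prems by simp
    finally show ?case by (simp only: sum.insert[OF insert.hyps])
  next
    case (infinite A)
    show ?case by (simp only: L0 sum.infinite[OF infinite.hyps])
  qed (simp only: L0 sum.empty)
qed

text \<open>
  Linearity is asked for on \<open>V\<close> only, since \<open>Ad g\<close> is meaningful only on \<open>Lie G\<close>.
\<close>

lemma matrix_in_basis_mult:
  assumes b: "basis_of V bs" and A: "linear_endo V A" and B: "linear_endo V B"
  shows "matrix_in_basis bs (\<lambda>v. A (B v)) = matrix_in_basis bs A * matrix_in_basis bs B"
proof (rule eq_matI)
  let ?rep = "FS.representation (set bs)"
  have ind: "FS.independent (set bs)" and sp: "FS.span (set bs) = V" and dist: "distinct bs"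
    using b by (auto simp: basis_of_def)
  have sub: "FS.subspace V" using sp FS.subspace_span by blast
  have bV: "v \<in> V" if "v \<in> set bs" for v using that sp FS.span_base by blast
  have idx: "(\<Sum>k<length bs. g (bs ! k)) = (\<Sum>v\<in>set bs. g v)" for g :: "('a \<Rightarrow> 'b) \<Rightarrow> 'c::comm_monoid_add"
    by (rule sum.reindex_bij_betw) (simp add: bij_betw_nth dist)
  fix i j assume "i < dim_row (matrix_in_basis bs A * matrix_in_basis bs B)"
    "j < dim_col (matrix_in_basis bs A * matrix_in_basis bs B)"
  then have ij: "i < length bs" "j < length bs" by (auto simp: matrix_in_basis_def)
  have BV: "B (bs ! j) \<in> V" using B bV[of "bs ! j"] ij by (auto simp: linear_endo_def)
  have "B (bs ! j) = (\<Sum>v\<in>set bs. fscale (?rep (B (bs ! j)) v) v)"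
    using FS.sum_representation_eq[OF ind, of "B (bs ! j)" "set bs"] BV sp by simp
  then have "A (B (bs ! j)) = (\<Sum>v\<in>set bs. fscale (?rep (B (bs ! j)) v) (A v))"
    using linear_endo_sum[OF A sub bV, of "set bs" "\<lambda>v. v" "?rep (B (bs ! j))"] by (simp only:)
  moreover have AV: "A v \<in> V" if "v \<in> set bs" for v
    using bV[OF that] A unfolding linear_endo_def by (simp only:)
  ultimately have "?rep (A (B (bs ! j))) (bs ! i)
      = (\<Sum>v\<in>set bs. ?rep (fscale (?rep (B (bs ! j)) v) (A v)) (bs ! i))"
    using FS.representation_sum[OF ind, of "set bs" "\<lambda>v. fscale (?rep (B (bs ! j)) v) (A v)"] sp sub
    by (simp add: FS.subspace_scale)
  also have "\<dots> = (\<Sum>v\<in>set bs. ?rep (A v) (bs ! i) * ?rep (B (bs ! j)) v)"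
    by (rule sum.cong) (use AV sp in \<open>auto simp: FS.representation_scale[OF ind]\<close>)
  also have "\<dots> = (\<Sum>k<length bs. ?rep (A (bs ! k)) (bs ! i) * ?rep (B (bs ! j)) (bs ! k))"
    by (rule idx[symmetric])
  finally show "matrix_in_basis bs (\<lambda>v. A (B v)) $$ (i, j) = (matrix_in_basis bs A * matrix_in_basis bs B) $$ (i, j)"
    using ij by (simp add: matrix_in_basis_def scalar_prod_def lessThan_atLeast0)
qed (simp_all add: matrix_in_basis_def)

lemma matrix_in_basis_cong:
  assumes b: "basis_of V bs" and "\<And>v. v \<in> V \<Longrightarrow> A v = B v"
  shows "matrix_in_basis bs A = matrix_in_basis bs B"
proof -
  have "set bs \<subseteq> V" using b FS.span_superset by (auto simp: basis_of_def)
  then have "A (bs ! j) = B (bs ! j)" if "j < length bs" for j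
    using that assms(2) nth_mem by blast
  then show ?thesis by (auto simp: matrix_in_basis_def)
qed

lemma matrix_in_basis_id:
  assumes "basis_of V bs" shows "matrix_in_basis bs (\<lambda>v. v) = 1\<^sub>m (length bs)"
proof (rule eq_matI)
  fix i j assume ij: "i < dim_row (1\<^sub>m (length bs))" "j < dim_col (1\<^sub>m (length bs))"
  have "FS.representation (set bs) (bs ! j) (bs ! i) = (if bs ! i = bs ! j then 1 else 0)"
    using assms ij by (simp add: FS.representation_basis basis_of_def)
  with ij assms show "matrix_in_basis bs (\<lambda>v. v) $$ (i, j) = 1\<^sub>m (length bs) $$ (i, j)"
    by (auto simp: matrix_in_basis_def basis_of_def nth_eq_iff_index_eq)
qed (simp_all add: matrix_in_basis_def)

lemma basis_of_exists:
  assumes "FS.subspace V" "FS.dim V > 0" shows "\<exists>bs. basis_of V bs"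
proof -
  obtain B where B: "B \<subseteq> V" "FS.independent B" "V \<subseteq> FS.span B" "card B = FS.dim V"
    using FS.basis_exists[of V] by blast
  then have "finite B" using assms(2) by (intro card_ge_0_finite) simp
  then obtain bs where "distinct bs" "set bs = B" using finite_distinct_list by blast
  moreover have "FS.span B = V" using B assms(1) FS.span_minimal by blast
  ultimately show ?thesis using B by (auto simp: basis_of_def)
qed

text \<open>
  The hypothesis of positive dimension guarantees a finite basis: the dimension of an
  infinite-dimensional space is zero by convention.
\<close>

lemma char_poly_on_conjugate:
  assumes V: "FS.subspace V" "FS.dim V > 0"
    and lin: "linear_endo V L" "linear_endo V S" "linear_endo V T"
    and inv: "\<And>v. v \<in> V \<Longrightarrow> S (T v) = v" "\<And>v. v \<in> V \<Longrightarrow> T (S v) = v"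
    and L': "\<And>v. v \<in> V \<Longrightarrow> L' v = S (L (T v))"
  shows "char_poly_on V L' = char_poly_on V L"
proof -
  define bs where "bs = (SOME bs. basis_of V bs)"
  have b: "basis_of V bs" unfolding bs_def using basis_of_exists[OF V] by (rule someI_ex)
  let ?M = "matrix_in_basis bs" and ?n = "length bs"
  have car: "?M F \<in> carrier_mat ?n ?n" for F by (simp add: matrix_in_basis_def)
  have LT: "linear_endo V (\<lambda>v. L (T v))" using lin unfolding linear_endo_def by metis
  have "?M L' = ?M S * (?M L * ?M T)"
    using matrix_in_basis_cong[OF b L'] matrix_in_basis_mult[OF b lin(2) LT]
      matrix_in_basis_mult[OF b lin(1,3)] by simp
  also have "\<dots> = ?M S * ?M L * ?M T" by (rule assoc_mult_mat[OF car car car, symmetric])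
  finally have "?M L' = ?M S * ?M L * ?M T" .
  moreover have "?M S * ?M T = 1\<^sub>m ?n" "?M T * ?M S = 1\<^sub>m ?n"
    using matrix_in_basis_mult[OF b lin(2,3)] matrix_in_basis_mult[OF b lin(3,2)]
      matrix_in_basis_cong[OF b inv(1)] matrix_in_basis_cong[OF b inv(2)] matrix_in_basis_id[OF b]
    by simp_all
  ultimately have "similar_mat (?M L') (?M L)"
    using car by (intro similar_matI[where P = "?M S" and Q = "?M T" and n = ?n])
      (simp_all add: mult_carrier_mat[where nr = ?n and n = ?n and nc = ?n])
  then show ?thesis unfolding char_poly_on_def bs_def[symmetric] by (rule char_poly_similar)
qed

section \<open>The adjoint representation of the normaliser\<close>

lemma conj_by_closed:
  assumes "subgroup G (GL n)" "g \<in> G" "x \<in> G" shows "conj_by n g x \<in> G"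
  unfolding conj_by_def using assms
  by (meson subgroup.m_closed subgroup.m_inv_closed)

lemma conj_by_conj_by:
  assumes "g \<in> carrier (GL n)" "h \<in> carrier (GL n)" "x \<in> carrier (GL n)"
  shows "conj_by n g (conj_by n h x) = conj_by n (g \<otimes>\<^bsub>GL n\<^esub> h) x"
proof -
  interpret group "GL n" by (rule group_GL)
  have "(g \<otimes>\<^bsub>GL n\<^esub> (h \<otimes>\<^bsub>GL n\<^esub> x \<otimes>\<^bsub>GL n\<^esub> inv\<^bsub>GL n\<^esub> h) \<otimes>\<^bsub>GL n\<^esub> inv\<^bsub>GL n\<^esub> g) =
    (g \<otimes>\<^bsub>GL n\<^esub> h \<otimes>\<^bsub>GL n\<^esub> x \<otimes>\<^bsub>GL n\<^esub> inv\<^bsub>GL n\<^esub> (g \<otimes>\<^bsub>GL n\<^esub> h))"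
    using assms by (simp only: inv_mult_group m_assoc m_closed inv_closed)
  then show ?thesis by (simp add: conj_by_def)
qed

lemma conj_by_one:
  assumes "x \<in> carrier (GL n)" shows "conj_by n \<one>\<^bsub>GL n\<^esub> x = x"
proof -
  interpret group "GL n" by (rule group_GL)
  have "\<one>\<^bsub>GL n\<^esub> \<otimes>\<^bsub>GL n\<^esub> x \<otimes>\<^bsub>GL n\<^esub> inv\<^bsub>GL n\<^esub> \<one>\<^bsub>GL n\<^esub> = x"
    using assms by (simp only: inv_one l_one r_one)
  then show ?thesis unfolding conj_by_def .
qed

text \<open>
  Stated for elements of the normaliser, so that \<open>Ad\<close> yields endomorphisms of \<open>Lie G\<close> for them as
  well. Conjugation is linear in the entries and preserves the determinant.
\<close>

lemma reg_conj_by: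
  assumes G: "G \<subseteq> carrier (GL n)" and g: "g \<in> carrier (GL n)"
    and norm: "\<And>x. x \<in> G \<Longrightarrow> conj_by n g x \<in> G" and f: "f \<in> regular_functions n G"
  shows "fun_on G (\<lambda>x. f (conj_by n g x)) \<in> regular_functions n G"
proof (rule regular_comp[OF f, where \<psi> = "conj_by n g"])
  show "conj_by n g x \<in> G" if "x \<in> G" for x using that by (rule norm)
next
  let ?h = "inv\<^bsub>GL n\<^esub> g"
  have c: "g \<in> carrier_mat n n" "?h \<in> carrier_mat n n" "g * ?h = 1\<^sub>m n"
    using GL_carrier_mat[OF g] GL_inv[OF g] by auto
  have x: "x \<in> carrier_mat n n" if "x \<in> G" for x using that G GL_carrier_mat by blast
  fix i j assume ij: "i < n" "j < n"
  have eq: "fun_on G (\<lambda>x. conj_by n g x $$ (i, j)) = fun_on G (\<lambda>x. \<Sum>l<n. g $$ (i, l) * (\<Sum>m<n. x $$ (l, m) * ?h $$ (m, j)))"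
  proof (rule fun_on_cong)
    fix x assume "x \<in> G"
    with ij c x[of x] show "conj_by n g x $$ (i, j) = (\<Sum>l<n. g $$ (i, l) * (\<Sum>m<n. x $$ (l, m) * ?h $$ (m, j)))"
      by (simp add: conj_by_def scalar_prod_def lessThan_atLeast0)
  qed
  show "fun_on G (\<lambda>x. conj_by n g x $$ (i, j)) \<in> regular_functions n G"
    unfolding eq by (intro reg_intros) (use ij in simp_all)
next
  let ?h = "inv\<^bsub>GL n\<^esub> g"
  have c: "g \<in> carrier_mat n n" "?h \<in> carrier_mat n n" "g * ?h = 1\<^sub>m n"
    using GL_carrier_mat[OF g] GL_inv[OF g] by auto
  have "fun_on G (\<lambda>x. inverse (det (conj_by n g x))) = fun_on G (\<lambda>x. inverse (det x))"
  proof (rule fun_on_cong)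
    fix x assume "x \<in> G"
    then have x: "x \<in> carrier_mat n n" using G GL_carrier_mat by blast
    have "det g * det ?h = 1" using det_mult[OF c(1,2)] c(3) by simp
    moreover have "det (g * x * ?h) = det x * (det g * det ?h)"
      using det_mult[OF mult_carrier_mat[OF c(1) x] c(2)] det_mult[OF c(1) x] by (simp only: ac_simps)
    ultimately have "det (g * x * ?h) = det x" by (simp only: mult_1_right)
    then show "inverse (det (conj_by n g x)) = inverse (det x)" by (simp add: conj_by_def)
  qed
  then show "fun_on G (\<lambda>x. inverse (det (conj_by n g x))) \<in> regular_functions n G"
    by (simp add: reg_inv_det)
qed

lemma subspace_lie_algebra: "FS.subspace (lie_algebra n G)"
  unfolding FS.subspace_def lie_algebra_def
  by (auto simp: fscale_def algebra_simps)

lemma reg_plus: "f \<in> regular_functions n X \<Longrightarrow> g \<in> regular_functions n X \<Longrightarrow> f + g \<in> regular_functions n X"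
  unfolding regular_functions_def by (rule gen_algebra.add)

lemma reg_times: "f \<in> regular_functions n X \<Longrightarrow> g \<in> regular_functions n X \<Longrightarrow> f * g \<in> regular_functions n X"
  unfolding regular_functions_def by (rule gen_algebra.mult)

lemma reg_fscale: "f \<in> regular_functions n X \<Longrightarrow> fscale c f \<in> regular_functions n X"
proof -
  assume f: "f \<in> regular_functions n X"
  have "fscale c f = fun_on X (\<lambda>_. c) * f"
  proof
    fix x show "fscale c f x = (fun_on X (\<lambda>_. c) * f) x"
      using fun_cong[OF regular_fun_on[OF f], of x] by (auto simp: fun_on_def fscale_def)
  qed
  with reg_times[OF reg_const f] show ?thesis by simp
qed

lemma linear_endo_Ad:
  assumes G: "subgroup G (GL n)" and g: "g \<in> carrier (GL n)"
    and norm: "\<And>x. x \<in> G \<Longrightarrow> conj_by n g x \<in> G"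
  shows "linear_endo (lie_algebra n G) (Ad n G g)"
proof -
  let ?R = "regular_functions n G" and ?c = "\<lambda>f. fun_on G (\<lambda>x. f (conj_by n g x))"
  have Gsub: "G \<subseteq> carrier (GL n)" using G by (rule subgroup.subset)
  have cR: "?c f \<in> ?R" if "f \<in> ?R" for f by (rule reg_conj_by[OF Gsub g norm that])
  have c_add: "?c (f + h) = ?c f + ?c h" and c_mult: "?c (f * h) = ?c f * ?c h" for f h :: "'a mat \<Rightarrow> 'a"
    by (auto simp: fun_on_def)
  have c_scale: "?c (fscale a f) = fscale a (?c f)" for a and f :: "'a mat \<Rightarrow> 'a"
    by (auto simp: fun_on_def fscale_def)
  have c_one: "?c f \<one>\<^bsub>GL n\<^esub> = f \<one>\<^bsub>GL n\<^esub>" for f :: "'a mat \<Rightarrow> 'a"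
  proof -
    interpret group "GL n" by (rule group_GL)
    have "conj_by n g \<one>\<^bsub>GL n\<^esub> = \<one>\<^bsub>GL n\<^esub>"
      unfolding conj_by_def using g by (simp only: r_one r_inv)
    then show ?thesis using subgroup.one_closed[OF G] by (simp only: fun_on_def if_True)
  qed
  have Ad: "Ad n G g \<delta> f = (if f \<in> ?R then \<delta> (?c f) else 0)" for \<delta> f
    by (simp add: Ad_def fun_on_def)
  show ?thesis unfolding linear_endo_def
  proof (intro conjI ballI allI)
    fix \<delta> assume \<delta>: "\<delta> \<in> lie_algebra n G"
    have \<delta>_add: "\<delta> (f + h) = \<delta> f + \<delta> h"
      and \<delta>_mult: "\<delta> (f * h) = \<delta> f * h \<one>\<^bsub>GL n\<^esub> + f \<one>\<^bsub>GL n\<^esub> * \<delta> h" if "f \<in> ?R" "h \<in> ?R" for f h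
      using \<delta> that unfolding lie_algebra_def by blast+
    have \<delta>_scale: "\<delta> (fscale a f) = a * \<delta> f" if "f \<in> ?R" for a f
      using \<delta> that unfolding lie_algebra_def by blast
    show "Ad n G g \<delta> \<in> lie_algebra n G"
      unfolding lie_algebra_def
    proof (intro CollectI conjI ballI allI impI)
      fix f h assume fh: "f \<in> ?R" "h \<in> ?R"
      show "Ad n G g \<delta> (f + h) = Ad n G g \<delta> f + Ad n G g \<delta> h"
        by (simp only: Ad fh reg_plus if_True c_add \<delta>_add cR)
      show "Ad n G g \<delta> (f * h) = Ad n G g \<delta> f * h \<one>\<^bsub>GL n\<^esub> + f \<one>\<^bsub>GL n\<^esub> * Ad n G g \<delta> h"
        by (simp only: Ad fh reg_times if_True c_mult \<delta>_mult cR c_one)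
    next
      fix f a assume f: "f \<in> ?R"
      show "Ad n G g \<delta> (fscale a f) = a * Ad n G g \<delta> f"
        by (simp only: Ad f reg_fscale if_True c_scale \<delta>_scale cR)
    qed (simp only: Ad if_False)
  qed (auto simp: Ad fscale_def)
qed

lemma Ad_Ad:
  assumes G: "subgroup G (GL n)" and g: "g \<in> carrier (GL n)" "h \<in> carrier (GL n)"
    and norm: "\<And>x. x \<in> G \<Longrightarrow> conj_by n g x \<in> G" "\<And>x. x \<in> G \<Longrightarrow> conj_by n h x \<in> G"
  shows "Ad n G g (Ad n G h \<delta>) = Ad n G (g \<otimes>\<^bsub>GL n\<^esub> h) \<delta>"
proof
  fix f :: "'a mat \<Rightarrow> 'a"
  have Gsub: "G \<subseteq> carrier (GL n)" using G by (rule subgroup.subset)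
  have "fun_on G (\<lambda>x. fun_on G (\<lambda>x. f (conj_by n g x)) (conj_by n h x)) = fun_on G (\<lambda>x. f (conj_by n (g \<otimes>\<^bsub>GL n\<^esub> h) x))"
    by (rule fun_on_cong) (use norm Gsub g in \<open>auto simp: fun_on_apply conj_by_conj_by subsetD simp del: GL_simps\<close>)
  then show "Ad n G g (Ad n G h \<delta>) f = Ad n G (g \<otimes>\<^bsub>GL n\<^esub> h) \<delta> f"
    using reg_conj_by[OF Gsub g(1) norm(1), of f]
    by (cases "f \<in> regular_functions n G") (simp_all only: Ad_def fun_on_def[of "regular_functions n G"] if_True if_False)
qed

lemma Ad_one:
  assumes G: "subgroup G (GL n)" and "\<delta> \<in> lie_algebra n G"
  shows "Ad n G \<one>\<^bsub>GL n\<^esub> \<delta> = \<delta>"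
proof
  fix f :: "'a mat \<Rightarrow> 'a"
  have "fun_on G (\<lambda>x. f (conj_by n \<one>\<^bsub>GL n\<^esub> x)) = fun_on G f"
    by (rule fun_on_cong) (use subgroup.subset[OF G] in \<open>auto simp: conj_by_one subsetD simp del: GL_simps\<close>)
  then show "Ad n G \<one>\<^bsub>GL n\<^esub> \<delta> f = \<delta> f"
    using assms(2) by (auto simp: Ad_def fun_on_def regular_fun_on[unfolded fun_on_def] lie_algebra_def)
qed

text \<open>
  On the normaliser \<open>Ad\<close> is multiplicative, hence \<open>Ad(P x P\<^sup>-\<^sup>1)\<close> is the conjugate of \<open>Ad x\<close> by
  \<open>Ad P\<close> and has the same characteristic polynomial. A coefficient exists only if the dimension of
  \<open>Lie G\<close> is positive, and this already provides a finite basis.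
\<close>

lemma char_coeffs_normaliser_invariant:
  assumes G: "subgroup G (GL n)" and P: "P \<in> carrier (GL n)"
    and norm: "\<And>x. x \<in> G \<Longrightarrow> conj_by n P x \<in> G" "\<And>x. x \<in> G \<Longrightarrow> conj_by n (inv\<^bsub>GL n\<^esub> P) x \<in> G"
    and f: "f \<in> gen_algebra G (char_coeffs G (lie_algebra n G) (Ad n G))"
    and x: "x \<in> G"
  shows "f (conj_by n P x) = f x"
  using f
proof induction
  case (incl f)
  interpret group "GL n" by (rule group_GL)
  let ?V = "lie_algebra n G" and ?Q = "inv\<^bsub>GL n\<^esub> P"
  from incl obtain i where i: "f = fun_on G (\<lambda>g. poly.coeff (char_poly_on ?V (Ad n G g)) (FS.dim ?V - i))"
    "i \<in> {1..FS.dim ?V}" unfolding char_coeffs_def by blast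
  have xc: "x \<in> carrier (GL n)" using subgroup.subset[OF G] x by blast
  have Q: "?Q \<in> carrier (GL n)" using P by simp
  have nx: "conj_by n x y \<in> G" if "y \<in> G" for y using conj_by_closed[OF G x that] .
  have xQ: "x \<otimes>\<^bsub>GL n\<^esub> ?Q \<in> carrier (GL n)" using xc Q by (rule m_closed)
  have nxQ: "conj_by n (x \<otimes>\<^bsub>GL n\<^esub> ?Q) y \<in> G" if "y \<in> G" for y
  proof -
    have yc: "y \<in> carrier (GL n)" using subgroup.subset[OF G] that by blast
    show ?thesis using conj_by_conj_by[OF xc Q yc] nx norm(2) that by metis
  qed
  have "char_poly_on ?V (Ad n G (conj_by n P x)) = char_poly_on ?V (Ad n G x)"
  proof (rule char_poly_on_conjugate[where S = "Ad n G P" and T = "Ad n G ?Q"])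
    show "FS.subspace ?V" by (rule subspace_lie_algebra)
    show "FS.dim ?V > 0" using i(2) by auto
    show "linear_endo ?V (Ad n G x)" by (rule linear_endo_Ad[OF G xc nx])
    show "linear_endo ?V (Ad n G P)" by (rule linear_endo_Ad[OF G P norm(1)])
    show "linear_endo ?V (Ad n G ?Q)" by (rule linear_endo_Ad[OF G Q norm(2)])
    fix \<delta> assume \<delta>: "\<delta> \<in> ?V"
    show "Ad n G P (Ad n G ?Q \<delta>) = \<delta>"
      using Ad_Ad[OF G P Q norm] Ad_one[OF G \<delta>] r_inv[OF P] by (simp del: GL_simps)
    show "Ad n G ?Q (Ad n G P \<delta>) = \<delta>"
      using Ad_Ad[OF G Q P norm(2,1)] Ad_one[OF G \<delta>] l_inv[OF P] by (simp del: GL_simps)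
    have "Ad n G P (Ad n G x (Ad n G ?Q \<delta>)) = Ad n G (P \<otimes>\<^bsub>GL n\<^esub> (x \<otimes>\<^bsub>GL n\<^esub> ?Q)) \<delta>"
      using Ad_Ad[OF G P xQ norm(1) nxQ] Ad_Ad[OF G xc Q nx norm(2)] by (simp del: GL_simps)
    then show "Ad n G (conj_by n P x) \<delta> = Ad n G P (Ad n G x (Ad n G ?Q \<delta>))"
      using P xc Q unfolding conj_by_def by (simp add: m_assoc del: GL_simps)
  qed
  then show ?case using x norm(1) i(1) by (simp add: fun_on_apply)
qed (use x norm(1) in \<open>auto simp: fun_on_def\<close>)

section \<open>Quadruples of determinant one\<close>

text \<open>
  The quadruple \<open>Q a b c d\<close> stands for the matrix with rows \<open>(a, b)\<close> and \<open>(c, d)\<close>. With the four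
  entries explicit, identities in \<open>SL\<^sub>2\<close> are polynomial identities.
\<close>

datatype 'k quad = Q 'k 'k 'k 'k

definition SL2 :: "'k::field quad set" where
  "SL2 = {Q a b c d | a b c d. a * d - b * c = 1}"

fun sl_mult :: "'k::field quad \<Rightarrow> 'k quad \<Rightarrow> 'k quad" where
  "sl_mult (Q a b c d) (Q a' b' c' d') = Q (a * a' + b * c') (a * b' + b * d') (c * a' + d * c') (c * b' + d * d')"

fun sl_inv :: "'k::field quad \<Rightarrow> 'k quad" where
  "sl_inv (Q a b c d) = Q d (- b) (- c) a"

definition sl_one :: "'k::field quad" where "sl_one = Q 1 0 0 1"
definition up :: "'k::field \<Rightarrow> 'k quad" where "up s = Q 1 s 0 1"
definition lo :: "'k::field \<Rightarrow> 'k quad" where "lo s = Q 1 0 s 1"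
definition dg :: "'k::field \<Rightarrow> 'k quad" where "dg t = Q t 0 0 (inverse t)"

lemma SL2_closed [simp]:
  "sl_one \<in> SL2" "up s \<in> SL2" "lo s \<in> SL2" "t \<noteq> 0 \<Longrightarrow> dg t \<in> SL2"
  by (simp_all add: SL2_def sl_one_def up_def lo_def dg_def)

lemma SL2_mult [simp]: "x \<in> SL2 \<Longrightarrow> y \<in> SL2 \<Longrightarrow> sl_mult x y \<in> SL2"
proof (cases x; cases y)
  fix a b c d a' b' c' d' assume *: "x \<in> SL2" "y \<in> SL2" "x = Q a b c d" "y = Q a' b' c' d'"
  have "(a * a' + b * c') * (c * b' + d * d') - (a * b' + b * d') * (c * a' + d * c')
      = (a * d - b * c) * (a' * d' - b' * c')" by (simp add: algebra_simps)
  with * show ?thesis by (simp add: SL2_def)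
qed

lemma SL2_inv [simp]: "x \<in> SL2 \<Longrightarrow> sl_inv x \<in> SL2"
  by (cases x) (simp add: SL2_def mult.commute)

lemma sl_mult_one [simp]: "sl_mult sl_one x = x" "sl_mult x sl_one = x"
  by (cases x; simp add: sl_one_def)+

lemma sl_inv_one [simp]: "sl_inv sl_one = sl_one"
  by (simp add: sl_one_def)

lemma sl_mult_inv [simp]: "x \<in> SL2 \<Longrightarrow> sl_mult x (sl_inv x) = sl_one" "x \<in> SL2 \<Longrightarrow> sl_mult (sl_inv x) x = sl_one"
  by (cases x; simp add: sl_one_def SL2_def algebra_simps)+

text \<open>
  Gaussian elimination: upper and lower transvections generate \<open>SL\<^sub>2\<close>. A matrix with \<open>c \<noteq> 0\<close> is a
  product \<open>up p \<cdot> lo c \<cdot> up r\<close>, and multiplication by \<open>lo 1\<close> reduces \<open>c = 0\<close> to that case.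
\<close>

lemma SL2_induct [consumes 1, case_names one up lo]:
  assumes "x \<in> SL2"
    and one: "P sl_one"
    and up: "\<And>x s. x \<in> SL2 \<Longrightarrow> P x \<Longrightarrow> P (sl_mult x (up s))"
    and lo: "\<And>x s. x \<in> SL2 \<Longrightarrow> P x \<Longrightarrow> P (sl_mult x (lo s))"
  shows "P x"
proof -
  have *: "P (Q a b c d)" if x: "(Q a b c d) \<in> SL2" and c: "c \<noteq> 0" for a b c d
  proof -
    define p r where "p = (a - 1) / c" and "r = (d - 1) / c"
    have "a * d = 1 + b * c" using x by (simp add: SL2_def algebra_simps)
    then have "p * c + 1 = a" "c * r + 1 = d" "a * r + p = b"
      using c by (simp_all add: p_def r_def field_simps)
    then have "sl_mult (sl_mult (sl_mult sl_one (up p)) (lo c)) (up r) = Q a b c d"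
      by (simp add: sl_one_def up_def lo_def add.commute)
    moreover have "P (sl_mult (sl_mult (sl_mult sl_one (up p)) (lo c)) (up r))"
      by (intro up lo one) simp_all
    ultimately show ?thesis by simp
  qed
  obtain a b c d where x: "x = Q a b c d" by (cases x)
  show ?thesis
  proof (cases "c = 0")
    case True
    then have d: "d \<noteq> 0" "a * d = 1" using assms(1) x by (auto simp: SL2_def)
    have m: "sl_mult x (lo 1) = Q (a + b) b d d" using True by (simp add: x lo_def)
    have "sl_mult x (lo 1) \<in> SL2" using assms(1) by simp
    with d have "P (sl_mult x (lo 1))" unfolding m by (intro *)
    then have "P (sl_mult (sl_mult x (lo 1)) (lo (-1)))"
      by (rule lo[rotated]) (use assms(1) in simp)
    then show ?thesis using True unfolding m by (simp add: lo_def x)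
  qed (use * assms(1) x in simp)
qed

section \<open>The symmetric square\<close>

text \<open>
  The action on the binary quadratic forms, each row collecting the coefficients of
  \<open>(aX + bY)\<^sup>2\<close>, \<open>2 (aX + bY) (cX + dY)\<close> and \<open>(cX + dY)\<^sup>2\<close>, where the middle coefficient is halved.
  The kernel on \<open>SL\<^sub>2\<close> is \<open>\<plusminus>1\<close>, so the image is \<open>PGL\<^sub>2\<close>; the factors \<open>2\<close> are
  placed so that this remains an embedding of \<open>PGL\<^sub>2\<close> in characteristic two.
\<close>

fun sym2 :: "'k::field quad \<Rightarrow> 'k mat" where
  "sym2 (Q a b c d) = mat_of_rows_list 3
     [[a * a, a * b, b * b], [2 * a * c, a * d + b * c, 2 * b * d], [c * c, c * d, d * d]]"

lemma sym2_carrier [simp]: "sym2 x \<in> carrier_mat 3 3"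
  by (cases x) (simp add: mat_of_rows_list_def numeral_3_eq_3)

lemma sym2_dim [simp]: "dim_row (sym2 x) = 3" "dim_col (sym2 x) = 3"
  using sym2_carrier[of x] by blast+

lemma less_3_cases: "(i::nat) < 3 \<Longrightarrow> i = 0 \<or> i = 1 \<or> i = 2" by auto

lemma sym2_index:
  "sym2 (Q a b c d) $$ (0, 0) = a * a" "sym2 (Q a b c d) $$ (0, 1) = a * b"
  "sym2 (Q a b c d) $$ (0, 2) = b * b" "sym2 (Q a b c d) $$ (1, 0) = 2 * a * c"
  "sym2 (Q a b c d) $$ (1, 1) = a * d + b * c" "sym2 (Q a b c d) $$ (1, 2) = 2 * b * d"
  "sym2 (Q a b c d) $$ (2, 0) = c * c" "sym2 (Q a b c d) $$ (2, 1) = c * d"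
  "sym2 (Q a b c d) $$ (2, 2) = d * d"
  by (simp_all add: mat_of_rows_list_def)

lemma sum_3: "(\<Sum>i = 0..<3. f i) = f 0 + f 1 + f (2::nat)"
  by (simp add: numeral_3_eq_3 numeral_2_eq_2)

lemma sym2_mult: "sym2 (sl_mult x y) = sym2 x * sym2 y"
proof (rule eq_matI)
  fix i j assume "i < dim_row (sym2 x * sym2 y)" "j < dim_col (sym2 x * sym2 y)"
  then have ij: "i < 3" "j < 3" by simp_all
  obtain a b c d where x: "x = Q a b c d" by (cases x)
  obtain a' b' c' d' where y: "y = Q a' b' c' d'" by (cases y)
  have "(sym2 x * sym2 y) $$ (i, j) = (\<Sum>l = 0..<3. sym2 x $$ (i, l) * sym2 y $$ (l, j))"
    using ij by (simp add: scalar_prod_def)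
  also have "\<dots> = sym2 (sl_mult x y) $$ (i, j)"
    using less_3_cases[OF ij(1)] less_3_cases[OF ij(2)] unfolding x y sl_mult.simps sum_3
    by (elim disjE) (simp_all add: sym2_index sym2_index[unfolded One_nat_def] algebra_simps del: sym2.simps)
  finally show "sym2 (sl_mult x y) $$ (i, j) = (sym2 x * sym2 y) $$ (i, j)" by simp
qed simp_all

lemma sym2_one [simp]: "sym2 sl_one = 1\<^sub>m 3"
proof (rule eq_matI)
  fix i j assume "i < dim_row (1\<^sub>m 3)" "j < dim_col (1\<^sub>m 3)"
  then have ij: "i < 3" "j < 3" by simp_all
  then show "sym2 sl_one $$ (i, j) = (1\<^sub>m 3 :: 'a mat) $$ (i, j)"
    using less_3_cases[OF ij(1)] less_3_cases[OF ij(2)] unfolding sl_one_def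
    by (elim disjE) (simp_all add: sym2_index sym2_index[unfolded One_nat_def] del: sym2.simps)
qed simp_all

lemma det_sym2:
  assumes "x \<in> SL2" shows "det (sym2 x) = 1"
  using assms
proof (induction rule: SL2_induct)
  case (up x s)
  have "upper_triangular (sym2 (up s))"
    by (rule upper_triangularI) (auto simp: up_def mat_of_rows_list_def nth_Cons' dest!: less_3_cases)
  then have "det (sym2 (up s)) = 1"
    by (subst det_upper_triangular[OF _ sym2_carrier])
      (simp_all add: diag_mat_def up_def mat_of_rows_list_def numeral_3_eq_3)
  with up show ?case by (simp add: sym2_mult det_mult[OF sym2_carrier sym2_carrier])
next
  case (lo x s)
  have "det (sym2 (lo s)) = 1"
    by (subst det_lower_triangular[OF _ sym2_carrier])
      (auto simp: diag_mat_def lo_def mat_of_rows_list_def numeral_3_eq_3 nth_Cons' less_Suc_eq)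
  with lo show ?case by (simp add: sym2_mult det_mult[OF sym2_carrier sym2_carrier])
qed simp

text \<open>
  The outer rows \<open>(a\<^sup>2, ab, b\<^sup>2)\<close> and \<open>(c\<^sup>2, cd, d\<^sup>2)\<close> determine the whole matrix. They lie on the
  cone \<open>q\<^sup>2 = pr\<close> and satisfy \<open>(ad - bc)\<^sup>2 = 1\<close>, and the middle row is recovered from them by multiplying
  \<open>2ac\<close>, \<open>ad + bc\<close> and \<open>2bd\<close> by \<open>ad - bc = 1\<close>.
\<close>

definition sym2_eqs :: "(nat \<Rightarrow> nat \<Rightarrow> 'k::field) \<Rightarrow> bool" where
  "sym2_eqs m \<longleftrightarrow> m 0 1 ^ 2 = m 0 0 * m 0 2 \<and> m 2 1 ^ 2 = m 2 0 * m 2 2 \<and>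
     m 0 0 * m 2 2 + m 0 2 * m 2 0 - 2 * m 0 1 * m 2 1 = 1 \<and>
     m 1 0 = 2 * (m 0 0 * m 2 1 - m 0 1 * m 2 0) \<and> m 1 1 = m 0 0 * m 2 2 - m 0 2 * m 2 0 \<and>
     m 1 2 = 2 * (m 0 1 * m 2 2 - m 0 2 * m 2 1)"

lemma sym2_eqs_sym2:
  assumes "x \<in> SL2" "\<And>i j. i < 3 \<Longrightarrow> j < 3 \<Longrightarrow> m i j = sym2 x $$ (i, j)"
  shows "sym2_eqs m"
proof -
  obtain a b c d where x: "x = Q a b c d" by (cases x)
  have det: "a * d - b * c = 1" using assms(1) by (simp add: x SL2_def)
  have *: "u * (a * d - b * c) = u" for u using det by simp
  have m: "m 0 0 = a * a" "m 0 1 = a * b" "m 0 2 = b * b" "m 1 0 = 2 * a * c"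
    "m 1 1 = a * d + b * c" "m 1 2 = 2 * b * d" "m 2 0 = c * c" "m 2 1 = c * d" "m 2 2 = d * d"
    by (simp_all add: assms(2) x sym2_index sym2_index[unfolded One_nat_def] del: sym2.simps)
  have "(a * d - b * c) * (a * d - b * c) = 1" using det by simp
  then show ?thesis
    unfolding sym2_eqs_def m using *[of "2 * a * c"] *[of "a * d + b * c"] *[of "2 * b * d"]
    by (simp add: power2_eq_square algebra_simps)
qed

text \<open>
  Square roots give \<open>a, b\<close> and \<open>c, d\<close> from the outer rows. The equations determine the determinant
  only up to sign, which is corrected by negating \<open>c\<close> and \<open>d\<close>, as the bottom row is quadratic in them.
\<close>

lemma sym2_surj:
  fixes m :: "nat \<Rightarrow> nat \<Rightarrow> 'k::alg_closed_field"
  assumes "sym2_eqs m"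
  shows "\<exists>x\<in>SL2. \<forall>i<3. \<forall>j<3. m i j = sym2 x $$ (i, j)"
proof -
  have top: "m 0 1 ^ 2 = m 0 0 * m 0 2" and bot: "m 2 1 ^ 2 = m 2 0 * m 2 2"
    and nrm: "m 0 0 * m 2 2 + m 0 2 * m 2 0 - 2 * m 0 1 * m 2 1 = 1"
    and mid: "m 1 0 = 2 * (m 0 0 * m 2 1 - m 0 1 * m 2 0)" "m 1 1 = m 0 0 * m 2 2 - m 0 2 * m 2 0"
      "m 1 2 = 2 * (m 0 1 * m 2 2 - m 0 2 * m 2 1)"
    using assms unfolding sym2_eqs_def by blast+
  have root: "\<exists>a b. p = a * a \<and> q = a * b \<and> r = b * b" if pqr: "q ^ 2 = p * r" for p q r :: 'k
  proof -
    obtain a b where ab: "a ^ 2 = p" "b ^ 2 = r" using nth_root_exists[of 2] by (metis zero_less_numeral)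
    have "q ^ 2 = (a * b) ^ 2" using pqr ab by (simp add: power_mult_distrib)
    then have "q = a * b \<or> q = a * (- b)" by (simp add: power2_eq_iff)
    then show ?thesis
    proof
      assume "q = a * b" with ab show ?thesis by (intro exI[of _ a] exI[of _ b]) (simp add: power2_eq_square)
    next
      assume "q = a * (- b)" with ab show ?thesis
        by (intro exI[of _ a] exI[of _ "- b"]) (simp add: power2_eq_square)
    qed
  qed
  obtain a b where ab: "m 0 0 = a * a" "m 0 1 = a * b" "m 0 2 = b * b" using root[OF top] by blast
  obtain c' d' where cd': "m 2 0 = c' * c'" "m 2 1 = c' * d'" "m 2 2 = d' * d'" using root[OF bot] by blast
  have "(a * d' - b * c') ^ 2 = 1"
    using nrm unfolding ab cd' by (simp add: power2_eq_square algebra_simps)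
  then have "a * d' - b * c' = 1 \<or> a * d' - b * c' = - 1" by (simp add: power2_eq_1_iff)
  then obtain c d where cd: "m 2 0 = c * c" "m 2 1 = c * d" "m 2 2 = d * d" and det: "a * d - b * c = 1"
  proof
    assume "a * d' - b * c' = - 1"
    then have "a * (- d') - b * (- c') = 1" by (simp add: algebra_simps)
    with cd' show thesis by (intro that[of "- c'" "- d'"]) simp_all
  qed (use cd' that in blast)
  have *: "u * (a * d - b * c) = u" for u using det by simp
  have mid': "m 1 0 = 2 * a * c" "m 1 1 = a * d + b * c" "m 1 2 = 2 * b * d"
    using mid *[of "2 * a * c"] *[of "a * d + b * c"] *[of "2 * b * d"] unfolding ab cd
    by (simp_all add: algebra_simps)
  have "m i j = sym2 (Q a b c d) $$ (i, j)" if "i < 3" "j < 3" for i j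
    using less_3_cases[OF that(1)] less_3_cases[OF that(2)]
    by (elim disjE) (simp_all add: sym2_index sym2_index[unfolded One_nat_def]
        ab ab[unfolded One_nat_def] cd cd[unfolded One_nat_def] mid' mid'[unfolded One_nat_def] del: sym2.simps)
  moreover have "(Q a b c d) \<in> SL2" using det by (simp add: SL2_def)
  ultimately show ?thesis by blast
qed

section \<open>The group of pairs\<close>

definition emb :: "'k::field quad \<Rightarrow> 'k quad \<Rightarrow> 'k mat" where
  "emb x y = four_block_mat (sym2 x) (0\<^sub>m 3 3) (0\<^sub>m 3 3) (sym2 y)"

definition pgl2_sq :: "'k::field mat set" where
  "pgl2_sq = {emb x y | x y. x \<in> SL2 \<and> y \<in> SL2}"

lemma emb_carrier [simp]: "emb x y \<in> carrier_mat 6 6"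
  using four_block_carrier_mat[of "sym2 x" 3 3 "sym2 y" 3 3 "0\<^sub>m 3 3" "0\<^sub>m 3 3"] by (simp add: emb_def)

lemma emb_dim [simp]: "dim_row (emb x y) = 6" "dim_col (emb x y) = 6"
  using emb_carrier[of x y] by blast+

lemma emb_index:
  "i < 6 \<Longrightarrow> j < 6 \<Longrightarrow> emb x y $$ (i, j) =
    (if i < 3 \<and> j < 3 then sym2 x $$ (i, j) else if 3 \<le> i \<and> 3 \<le> j then sym2 y $$ (i - 3, j - 3) else 0)"
  by (auto simp: emb_def)

lemma emb_mult: "emb x y * emb x' y' = emb (sl_mult x x') (sl_mult y y')"
  unfolding emb_def sym2_mult
  by (subst mult_four_block_mat[of _ 3 3 _ 3 _ 3 _ _ 3 _ 3])
    (simp_all add: mult_carrier_mat[OF sym2_carrier sym2_carrier] del: sym2.simps)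

lemma emb_one [simp]: "emb sl_one sl_one = 1\<^sub>m 6"
  by (simp add: emb_def)

lemma emb_GL:
  assumes "x \<in> SL2" "y \<in> SL2"
  shows "emb x y \<in> carrier (GL 6)" "inv\<^bsub>GL 6\<^esub> (emb x y) = emb (sl_inv x) (sl_inv y)"
  by (rule GL_I[where B = "emb (sl_inv x) (sl_inv y)"]; simp add: emb_mult assms)+

lemma emb_in_pgl2_sq [simp]: "x \<in> SL2 \<Longrightarrow> y \<in> SL2 \<Longrightarrow> emb x y \<in> pgl2_sq"
  by (auto simp: pgl2_sq_def)

lemma det_emb:
  assumes "x \<in> SL2" "y \<in> SL2" shows "det (emb x y) = 1"
  unfolding emb_def
  by (subst det_four_block_mat_lower_left_zero[of _ 3 _ 3]) (simp_all add: det_sym2 assms)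

lemma subgroup_pgl2_sq: "subgroup pgl2_sq (GL 6)"
proof (rule group.subgroupI[OF group_GL])
  show "pgl2_sq \<subseteq> carrier (GL 6)" by (auto simp: pgl2_sq_def emb_GL)
  show "pgl2_sq \<noteq> {}" using emb_in_pgl2_sq[OF SL2_closed(1) SL2_closed(1)] by blast
  show "inv\<^bsub>GL 6\<^esub> a \<in> pgl2_sq" if "a \<in> pgl2_sq" for a :: "'a mat"
    using that unfolding pgl2_sq_def by (force simp: emb_GL)
  show "a \<otimes>\<^bsub>GL 6\<^esub> b \<in> pgl2_sq" if "a \<in> pgl2_sq" "b \<in> pgl2_sq" for a b :: "'a mat"
    using that unfolding pgl2_sq_def by (force simp: emb_mult)
qed

lemma emb_conj:
  assumes "x \<in> SL2" "y \<in> SL2"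
  shows "conj_by 6 (emb x y) (emb x' y') = emb (sl_mult (sl_mult x x') (sl_inv x)) (sl_mult (sl_mult y y') (sl_inv y))"
  by (simp add: conj_by_def emb_GL assms emb_mult)

lemma closedin_pgl2_sq: "closedin (zariski 6) (pgl2_sq :: 'k::alg_closed_field mat set)"
proof (rule closedin_zariskiI)
  show "(pgl2_sq :: 'k mat set) \<subseteq> carrier (GL 6)" by (rule subgroup.subset[OF subgroup_pgl2_sq])
  fix A :: "'k mat"
  let ?X = "carrier (GL 6) :: 'k mat set"
  assume A: "A \<in> ?X"
    and van: "\<And>f. fun_on ?X f \<in> regular_functions 6 ?X \<Longrightarrow> (\<And>x. x \<in> pgl2_sq \<Longrightarrow> f x = 0) \<Longrightarrow> f A = 0"
  have van_eq: "f A = g A"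
    if "fun_on ?X f \<in> regular_functions 6 ?X" "fun_on ?X g \<in> regular_functions 6 ?X"
      "\<And>x. x \<in> pgl2_sq \<Longrightarrow> f x = g x" for f g
    using van[OF reg_diff[OF that(1,2)]] that(3) by simp
  have block: "\<exists>x\<in>SL2. \<forall>i<3. \<forall>j<3. A $$ (k + i, k + j) = sym2 x $$ (i, j)" if k: "k = 0 \<or> k = 3" for k
  proof (rule sym2_surj)
    have E: "sym2_eqs (\<lambda>i j. x $$ (k + i, k + j))" if "x \<in> pgl2_sq" for x :: "'k mat"
    proof -
      from that obtain y z where yz: "y \<in> SL2" "z \<in> SL2" "x = emb y z" by (auto simp: pgl2_sq_def)
      show ?thesis
      proof (rule sym2_eqs_sym2)
        show "(if k = 0 then y else z) \<in> SL2" using yz by simp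
        show "x $$ (k + i, k + j) = sym2 (if k = 0 then y else z) $$ (i, j)" if "i < 3" "j < 3" for i j
          using k that by (auto simp: yz(3) emb_index)
      qed
    qed
    have k6: "k + 0 < 6" "k + 1 < 6" "k + 2 < 6" using k by auto
    show "sym2_eqs (\<lambda>i j. A $$ (k + i, k + j))"
      unfolding sym2_eqs_def
      by (intro conjI; rule van_eq; (intro reg_intros k6)?; use E in \<open>simp add: sym2_eqs_def\<close>)
  qed
  have off: "A $$ (i, j) = 0" if "i < 6" "j < 6" "\<not> (i < 3 \<longleftrightarrow> j < 3)" for i j
  proof (rule van)
    show "fun_on ?X (\<lambda>A. A $$ (i, j)) \<in> regular_functions 6 ?X" using that by (intro reg_entry)
    show "x $$ (i, j) = 0" if "x \<in> pgl2_sq" for x :: "'k mat"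
      using that \<open>i < 6\<close> \<open>j < 6\<close> \<open>\<not> (i < 3 \<longleftrightarrow> j < 3)\<close> by (auto simp: pgl2_sq_def emb_index)
  qed
  obtain x where x: "x \<in> SL2" "\<And>i j. i < 3 \<Longrightarrow> j < 3 \<Longrightarrow> A $$ (i, j) = sym2 x $$ (i, j)"
    using block[of 0] by auto
  obtain y where y: "y \<in> SL2" "\<And>i j. i < 3 \<Longrightarrow> j < 3 \<Longrightarrow> A $$ (3 + i, 3 + j) = sym2 y $$ (i, j)"
    using block[of 3] by auto
  have "A = emb x y"
  proof (rule eq_matI)
    fix i j assume "i < dim_row (emb x y)" "j < dim_col (emb x y)"
    then have ij: "i < 6" "j < 6" by simp_all
    show "A $$ (i, j) = emb x y $$ (i, j)"
      using x(2)[of i j] y(2)[of "i - 3" "j - 3"] off[OF ij] ij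
      by (cases "i < 3"; cases "j < 3") (simp_all add: emb_index)
  qed (use GL_carrier_mat[OF A] in auto)
  with x y show "A \<in> pgl2_sq" by simp
qed

text \<open>
  The first argument goes into the factor selected by the Boolean and the second into the other one,
  so that statements about one factor cover both.
\<close>

definition emb_at :: "bool \<Rightarrow> 'k::field quad \<Rightarrow> 'k quad \<Rightarrow> 'k mat" where
  "emb_at e x y = (if e then emb x y else emb y x)"

lemma emb_at_simps:
  "emb_at e x y * emb_at e x' y' = emb_at e (sl_mult x x') (sl_mult y y')"
  "emb_at e sl_one sl_one = 1\<^sub>m 6"
  by (simp_all add: emb_at_def emb_mult)

lemma emb_at_in_pgl2_sq [simp]: "x \<in> SL2 \<Longrightarrow> y \<in> SL2 \<Longrightarrow> emb_at e x y \<in> pgl2_sq"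
  by (simp add: emb_at_def)

lemma emb_at_inv: "x \<in> SL2 \<Longrightarrow> y \<in> SL2 \<Longrightarrow> inv\<^bsub>GL 6\<^esub> (emb_at e x y) = emb_at e (sl_inv x) (sl_inv y)"
  by (simp add: emb_at_def emb_GL)

lemma emb_at_conj:
  assumes "x \<in> SL2" "y \<in> SL2"
  shows "conj_by 6 (emb_at e x y) (emb_at e x' y') =
    emb_at e (sl_mult (sl_mult x x') (sl_inv x)) (sl_mult (sl_mult y y') (sl_inv y))"
  using assms by (simp add: emb_at_def emb_conj)

lemma emb_eqD:
  assumes "emb x y = emb x' y'" shows "sym2 x = sym2 x'" "sym2 y = sym2 y'"
proof -
  show "sym2 x = sym2 x'"
  proof (rule eq_matI)
    fix i j assume "i < dim_row (sym2 x')" "j < dim_col (sym2 x')"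
    then have "i < 3" "j < 3" by simp_all
    then show "sym2 x $$ (i, j) = sym2 x' $$ (i, j)"
      using emb_index[of i j x y] emb_index[of i j x' y'] assms by simp
  qed simp_all
  show "sym2 y = sym2 y'"
  proof (rule eq_matI)
    fix i j assume "i < dim_row (sym2 y')" "j < dim_col (sym2 y')"
    then have "i < 3" "j < 3" by simp_all
    then show "sym2 y $$ (i, j) = sym2 y' $$ (i, j)"
      using emb_index[of "i + 3" "j + 3" x y] emb_index[of "i + 3" "j + 3" x' y'] assms by simp
  qed simp_all
qed

section \<open>Connectedness\<close>

lemma poly_curve_emb_at:
  assumes g: "g = up \<or> g = lo" and xy: "x \<in> SL2" "y \<in> SL2"
  shows "poly_curve 6 (\<lambda>s. emb_at e (sl_mult x (g s)) y)"
proof -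
  have 0: "poly_fun (\<lambda>s. sym2 (g s) $$ (i, j))" if "i < 3" "j < 3" for i j
    using g less_3_cases[OF that(1)] less_3_cases[OF that(2)] unfolding up_def lo_def
    by (elim disjE) (simp_all add: sym2_index sym2_index[unfolded One_nat_def] poly_fun_intros del: sym2.simps)
  have 1: "poly_fun (\<lambda>s. sym2 (sl_mult x (g s)) $$ (i, j))" if "i < 3" "j < 3" for i j
  proof -
    have "poly_fun (\<lambda>s. \<Sum>l = 0..<3. sym2 x $$ (i, l) * sym2 (g s) $$ (l, j))"
      using that 0 by (intro poly_fun_sum poly_fun_intros(2,4)) simp
    then show ?thesis using that by (simp add: sym2_mult scalar_prod_def)
  qed
  have "poly_fun (\<lambda>s. emb_at e (sl_mult x (g s)) y $$ (i, j))" if ij: "i < 6" "j < 6" for i j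
    by (cases e; cases "i < 3"; cases "j < 3"; use ij in \<open>simp add: emb_at_def emb_index 1 poly_fun_intros\<close>)
  moreover have "g s \<in> SL2" for s using g by auto
  ultimately show ?thesis
    using xy by (auto simp: poly_curve_def emb_at_def det_emb)
qed

text \<open>
  The connected subsets of the group through the identity have a connected union \<open>\<Union>F\<close>. It is stable under
  multiplication by a transvection in either factor, since the transvections form a connected curve
  through the identity; hence it is the whole group.
\<close>

lemma connectedin_pgl2_sq:
  "connectedin (zariski 6) (pgl2_sq :: 'k::alg_closed_field mat set)"
proof -
  let ?G = "pgl2_sq :: 'k mat set"
  define F where "F = {S. connectedin (zariski 6) S \<and> S \<subseteq> ?G \<and> 1\<^sub>m 6 \<in> S}"
  have GL: "?G \<subseteq> carrier (GL 6)" by (rule subgroup.subset[OF subgroup_pgl2_sq])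
  have one: "1\<^sub>m 6 \<in> ?G" using emb_in_pgl2_sq[of sl_one sl_one] by simp
  have step: "emb_at e (sl_mult x (g s)) y \<in> \<Union>F"
    if g: "g = up \<or> g = lo" and xy: "x \<in> SL2" "y \<in> SL2" and F: "emb_at e x y \<in> \<Union>F" for e g x y s
  proof -
    let ?c = "\<lambda>s. emb_at e (sl_mult x (g s)) y"
    obtain S where S: "S \<in> F" "emb_at e x y \<in> S" using F by blast
    have cG: "?c s \<in> ?G" for s using g xy by auto
    have "connectedin (zariski 6) (range ?c)"
      by (rule connectedin_poly_curve[OF poly_curve_emb_at[OF g xy]]) (use cG GL in blast)
    moreover have "sl_mult x (g 0) = x"
      using g by (cases x) (auto simp: up_def lo_def)
    then have "emb_at e x y \<in> S \<inter> range ?c" using S by (auto intro!: image_eqI[where x = 0])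
    ultimately have "connectedin (zariski 6) (S \<union> range ?c)"
      using S(1) by (intro connectedin_Un) (auto simp: F_def)
    then have "S \<union> range ?c \<in> F" using S(1) cG by (auto simp: F_def)
    then show ?thesis by blast
  qed
  have "{1\<^sub>m 6} \<in> F"
    unfolding F_def using one GL by (simp add: connectedin_sing subsetD)
  then have 0: "emb_at e sl_one sl_one \<in> \<Union>F" for e
    unfolding emb_at_simps by blast
  have 1: "emb_at e x sl_one \<in> \<Union>F" if "x \<in> SL2" for x e
    using that by (induction rule: SL2_induct) (use 0 step[of up] step[of lo] SL2_closed(1) in blast)+
  have 2: "emb_at False y x \<in> \<Union>F" if "y \<in> SL2" "x \<in> SL2" for x y
    using that(1)
  proof (induction rule: SL2_induct)
    case one
    then show ?case using 1[OF that(2), of True] by (simp add: emb_at_def)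
  qed (use step[of up] step[of lo] that(2) in blast)+
  have "?G \<subseteq> \<Union>F"
  proof
    fix z assume "z \<in> ?G"
    then obtain x y where "x \<in> SL2" "y \<in> SL2" "z = emb x y" by (auto simp: pgl2_sq_def)
    then show "z \<in> \<Union>F" using 2[of y x] by (simp add: emb_at_def)
  qed
  then have "?G = \<Union>F" by (auto simp: F_def)
  moreover have "connectedin (zariski 6) (\<Union>F)"
    using 0[of True] by (intro connectedin_Union) (auto simp: F_def)
  ultimately show ?thesis by simp
qed

section \<open>Semisimplicity\<close>

lemma ex_square_neq_1:
  "\<exists>t::'k::alg_closed_field. t \<noteq> 0 \<and> t * t \<noteq> 1"
proof -
  have "\<exists>t. poly ([:0, 1:] * ([:0, 0, 1:] - 1)) t \<noteq> (0 :: 'k)"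
  proof (rule ccontr)
    assume "\<nexists>t. poly ([:0, 1:] * ([:0, 0, 1:] - 1)) t \<noteq> (0 :: 'k)"
    then have "[:0, 1:] * ([:0, 0, 1:] - 1) = (0 :: 'k poly)"
      by (intro poly_fun_eqD[of "{}"]) auto
    then show False by (simp add: one_pCons)
  qed
  then show ?thesis by auto
qed

lemma SL2_triangular_conjugate:
  fixes x :: "'k::alg_closed_field quad"
  assumes "x \<in> SL2"
  shows "\<exists>g\<in>SL2. \<exists>a b d. sl_mult (sl_mult g x) (sl_inv g) = Q a b 0 d"
proof -
  obtain a b c d where x: "x = Q a b c d" by (cases x)
  show ?thesis
  proof (cases "b = 0")
    case True
    then show ?thesis
      by (intro bexI[of _ "Q 0 1 (-1) 0"]) (auto simp: x SL2_def)
  next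
    case False
    \<comment> \<open>Conjugating by \<open>lo z\<close> replaces \<open>c\<close> by this quadratic polynomial in \<open>z\<close>.\<close>
    then obtain z where "poly [:c, a - d, - b:] z = 0"
      using alg_closed_imp_poly_has_root[of "[:c, a - d, - b:]"] by auto
    then have "c + z * (a - d) - z * z * b = 0" by (simp add: algebra_simps)
    then have "sl_mult (sl_mult (lo z) x) (sl_inv (lo z)) = Q (a - b * z) b 0 (z * b + d)"
      by (simp add: x lo_def algebra_simps)
    then show ?thesis by (intro bexI[of _ "lo z"]) auto
  qed
qed

text \<open>
  Conjugation by \<open>dg t\<close> multiplies the parameter of a transvection by \<open>t\<^sup>2\<close>, an arbitrary nonzero
  scalar, and the Weyl element \<open>Q 0 1 (-1) 0\<close> exchanges upper and lower transvections.
\<close>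

lemma SL2_normal_closure:
  fixes M :: "'k::alg_closed_field quad set"
  assumes conj: "\<And>g x. g \<in> SL2 \<Longrightarrow> x \<in> M \<Longrightarrow> sl_mult (sl_mult g x) (sl_inv g) \<in> M"
    and mult: "\<And>x y. x \<in> M \<Longrightarrow> y \<in> M \<Longrightarrow> sl_mult x y \<in> M"
    and one: "sl_one \<in> M" and r: "up r \<in> M" "r \<noteq> 0"
  shows "SL2 \<subseteq> M"
proof
  have up: "up s \<in> M" for s
  proof (cases "s = 0")
    case True with one show ?thesis by (simp add: up_def sl_one_def)
  next
    case False
    obtain t where t: "t ^ 2 = s / r" using nth_root_exists[of 2] by (metis zero_less_numeral)
    with False r(2) have t0: "t \<noteq> 0" by auto
    have "t * t * r = s" using t r(2) by (simp add: power2_eq_square)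
    then have "sl_mult (sl_mult (dg t) (up r)) (sl_inv (dg t)) = up s"
      using t0 by (simp add: dg_def up_def mult_ac)
    with conj[OF SL2_closed(4)[OF t0] r(1)] show ?thesis by simp
  qed
  have lo: "lo s \<in> M" for s
  proof -
    have "sl_mult (sl_mult (Q 0 1 (-1) 0) (up (- s))) (sl_inv (Q 0 1 (-1) 0)) = lo s"
      by (simp add: up_def lo_def)
    then show ?thesis using conj[OF _ up, of "Q 0 1 (-1) 0" "- s"] by (simp add: SL2_def)
  qed
  fix x :: "'k quad" assume "x \<in> SL2"
  then show "x \<in> M" by (induction rule: SL2_induct) (use one mult up lo in auto)
qed

text \<open>
  For \<open>a\<^sup>2 \<noteq> 1\<close> the diagonal part acts nontrivially on transvections. For \<open>a\<^sup>2 = 1\<close> the element \<open>x\<close> is,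
  up to sign, itself a nontrivial transvection, and its commutator with a diagonal matrix is one too.
\<close>

lemma commutator_transvection:
  fixes x :: "'k::alg_closed_field quad"
  assumes x: "x = Q a b 0 d" "x \<in> SL2" and nc: "sym2 x \<noteq> 1\<^sub>m 3"
  shows "\<exists>h\<in>SL2. \<exists>r. r \<noteq> 0 \<and> sl_mult x (sl_mult (sl_mult h (sl_inv x)) (sl_inv h)) = up r"
proof (cases "a * a = 1")
  case False
  have ad: "a * d = 1" using x by (simp add: SL2_def)
  have "sl_mult x (sl_mult (sl_mult (up 1) (sl_inv x)) (sl_inv (up 1))) = up (a * a - 1)"
    using ad by (simp add: x up_def algebra_simps)
  with False show ?thesis by (intro bexI[of _ "up 1"] exI[of _ "a * a - 1"]) auto
next
  case True
  have ad: "a * d = 1" using x by (simp add: SL2_def)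
  with True have d: "d = a" by (metis mult.left_commute mult_1_right)
  have "b \<noteq> 0"
  proof
    assume "b = 0"
    have "sym2 x = 1\<^sub>m 3"
    proof (rule eq_matI)
      fix i j assume "i < dim_row (1\<^sub>m 3)" "j < dim_col (1\<^sub>m 3)"
      then have ij: "i < 3" "j < 3" by simp_all
      then show "sym2 x $$ (i, j) = (1\<^sub>m 3 :: 'k mat) $$ (i, j)"
        using less_3_cases[OF ij(1)] less_3_cases[OF ij(2)] \<open>b = 0\<close> True unfolding x(1) d
        by (elim disjE) (simp_all add: sym2_index sym2_index[unfolded One_nat_def] del: sym2.simps)
    qed simp_all
    with nc show False by simp
  qed
  obtain t :: 'k where t: "t \<noteq> 0" "t * t \<noteq> 1" using ex_square_neq_1 by blast
  let ?r = "a * b * (1 - t * t)"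
  have "a \<noteq> 0" using True by auto
  then have "?r \<noteq> 0" using t \<open>b \<noteq> 0\<close> by auto
  moreover have "sl_mult x (sl_mult (sl_mult (dg t) (sl_inv x)) (sl_inv (dg t))) = up ?r"
    using True t by (simp add: x d up_def dg_def algebra_simps)
  ultimately show ?thesis using t by (intro bexI[of _ "dg t"] exI[of _ ?r]) auto
qed

text \<open>
  \<open>SL\<^sub>2\<close> is perfect: the commutator of \<open>dg t\<close> with a transvection is a transvection whose parameter is
  multiplied by \<open>t\<^sup>2 - 1\<close> or \<open>t\<^sup>-\<^sup>2 - 1\<close>.
\<close>

lemma derived_contains_factor:
  fixes K :: "'k::alg_closed_field mat set"
  assumes H: "subgroup N (GL 6)" and K: "K \<subseteq> N"
    and x: "\<And>x. x \<in> SL2 \<Longrightarrow> emb_at e x sl_one \<in> K"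
    and y: "y \<in> SL2"
  shows "emb_at e y sl_one \<in> derived (subgrp 6 N) K"
proof -
  let ?E = "\<lambda>x. emb_at e x sl_one" and ?D = "derived (subgrp 6 N) K"
  have inv: "inv\<^bsub>subgrp 6 N\<^esub> (?E x) = ?E (sl_inv x)" if "x \<in> SL2" for x :: "'k quad"
    using group.m_inv_consistent[OF group_GL H, of "?E x"] assms(3)[OF that] K that
    by (auto simp: emb_at_inv)
  have comm: "?E (sl_mult (sl_mult (sl_mult g h) (sl_inv g)) (sl_inv h)) \<in> ?D"
    if gh: "g \<in> SL2" "h \<in> SL2" for g h :: "'k quad"
  proof -
    have "?E g \<otimes>\<^bsub>subgrp 6 N\<^esub> ?E h \<otimes>\<^bsub>subgrp 6 N\<^esub> inv\<^bsub>subgrp 6 N\<^esub> (?E g) \<otimes>\<^bsub>subgrp 6 N\<^esub> inv\<^bsub>subgrp 6 N\<^esub> (?E h)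
        \<in> ?D"
      unfolding derived_def using x gh by (intro generate.incl) blast
    then show ?thesis unfolding inv[OF gh(1)] inv[OF gh(2)] by (simp add: emb_at_simps)
  qed
  have mult: "?E (sl_mult g h) \<in> ?D" if "?E g \<in> ?D" "?E h \<in> ?D" for g h
    using generate.eng[OF that[unfolded derived_def]] by (simp add: derived_def emb_at_simps)
  obtain t :: 'k where t: "t \<noteq> 0" "t * t \<noteq> 1" using ex_square_neq_1 by blast
  have geo: "c * (s / (c - 1)) - s / (c - 1) = s" if "c \<noteq> 1" for c s :: 'k
  proof -
    have "c * (s / (c - 1)) - s / (c - 1) = (c - 1) * (s / (c - 1))" by (simp only: left_diff_distrib mult_1)
    then show ?thesis using that by simp
  qed
  have up: "?E (up s) \<in> ?D" for s
  proof -
    let ?r = "s / (t * t - 1)"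
    have "t * t * ?r - ?r = s" using t(2) by (rule geo)
    then have "sl_mult (sl_mult (sl_mult (dg t) (up ?r)) (sl_inv (dg t))) (sl_inv (up ?r)) = up s"
      using t by (simp add: dg_def up_def mult_ac)
    with comm[of "dg t" "up ?r"] t show ?thesis by simp
  qed
  have lo: "?E (lo s) \<in> ?D" for s
  proof -
    let ?q = "inverse t"
    have q: "?q * ?q \<noteq> 1" using t by (metis inverse_inverse_eq inverse_mult_distrib inverse_1)
    let ?r = "s / (?q * ?q - 1)"
    have "?q * ?q * ?r - ?r = s" using q by (rule geo)
    then have "sl_mult (sl_mult (sl_mult (dg t) (lo ?r)) (sl_inv (dg t))) (sl_inv (lo ?r)) = lo s"
      using t by (simp add: dg_def lo_def mult_ac)
    with comm[of "dg t" "lo ?r"] t show ?thesis by simp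
  qed
  show ?thesis
    using y
  proof (induction rule: SL2_induct)
    case one
    have "\<one>\<^bsub>subgrp 6 N\<^esub> \<in> ?D" unfolding derived_def by (rule generate.one)
    then show ?case by (simp add: emb_at_simps)
  qed (use mult up lo in auto)
qed

lemma solvable_no_factor:
  fixes N :: "'k::alg_closed_field mat set"
  assumes N: "subgroup N (GL 6)" and sol: "solvable (subgrp 6 N)"
    and x: "\<And>x. x \<in> SL2 \<Longrightarrow> emb_at e x sl_one \<in> N"
  shows False
proof -
  interpret H: group "subgrp 6 N" by (rule subgroup.subgroup_is_group[OF N group_GL])
  obtain n where n: "(derived (subgrp 6 N) ^^ n) N = {1\<^sub>m 6}"
    using H.solvable_iff_trivial_derived_seq sol by auto
  have "(derived (subgrp 6 N) ^^ m) N \<subseteq> N \<and> (\<forall>x\<in>SL2. emb_at e x sl_one \<in> (derived (subgrp 6 N) ^^ m) N)" for m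
  proof (induction m)
    case (Suc m)
    then have "derived (subgrp 6 N) ((derived (subgrp 6 N) ^^ m) N) \<subseteq> N"
      using H.derived_in_carrier[of "(derived (subgrp 6 N) ^^ m) N"] by simp
    with Suc show ?case using derived_contains_factor[OF N] by simp
  qed (use x in simp)
  then have "emb_at e (up 1) sl_one \<in> (derived (subgrp 6 N) ^^ n) N" by simp
  then have "emb_at e (up 1) sl_one = (1\<^sub>m 6 :: 'k mat)" using n by simp
  then have "sym2 (up 1) = (sym2 sl_one :: 'k mat)"
    using emb_eqD[of "up 1" sl_one sl_one sl_one] emb_eqD[of sl_one "up 1" sl_one sl_one]
    by (cases e) (simp_all add: emb_at_def)
  then have "sym2 (up 1) $$ (0, 1) = (sym2 sl_one :: 'k mat) $$ (0, 1)" by simp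
  then show False unfolding up_def sl_one_def sym2_index by simp
qed

text \<open>
  A nontrivial normal subgroup \<open>N\<close> contains an element whose component \<open>x\<close> in one of the factors is not
  central. A commutator with an element of that factor has trivial other component and, once \<open>x\<close>
  is triangular, is a transvection; so \<open>N\<close> contains that whole factor and is not solvable.
\<close>

lemma semisimple_pgl2_sq: "semisimple_group 6 (pgl2_sq :: 'k::alg_closed_field mat set)"
  unfolding semisimple_group_def linear_algebraic_group_def
proof (intro conjI allI impI subgroup_pgl2_sq closedin_pgl2_sq)
  fix N :: "'k mat set"
  assume "N \<lhd> subgrp 6 pgl2_sq \<and> closedin (zariski 6) N \<and> connectedin (zariski 6) N \<and> solvable (subgrp 6 N)"
  then have nor: "N \<lhd> subgrp 6 pgl2_sq" and sol: "solvable (subgrp 6 N)" by auto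
  have N: "subgroup N (GL 6)"
    by (rule group.incl_subgroup[OF group_GL subgroup_pgl2_sq normal_imp_subgroup[OF nor]])
  have Nsub: "N \<subseteq> pgl2_sq" using subgroup.subset[OF normal_imp_subgroup[OF nor]] by simp
  have conjN: "conj_by 6 g z \<in> N" if "g \<in> pgl2_sq" "z \<in> N" for g z
    using normal.inv_op_closed2[OF nor, of g z] that
    by (simp add: conj_by_def group.m_inv_consistent[OF group_GL subgroup_pgl2_sq])
  have multN: "z * z' \<in> N" if "z \<in> N" "z' \<in> N" for z z'
    using subgroup.m_closed[OF N that] by simp
  have oneN: "1\<^sub>m 6 \<in> N" using subgroup.one_closed[OF N] by simp
  show "N = {\<one>\<^bsub>GL 6\<^esub>}"
  proof (rule ccontr)
    assume "N \<noteq> {\<one>\<^bsub>GL 6\<^esub>}"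
    then obtain z where z: "z \<in> N" "z \<noteq> 1\<^sub>m 6" using oneN by auto
    then obtain x0 y0 where "x0 \<in> SL2" "y0 \<in> SL2" "z = emb x0 y0" using Nsub by (auto simp: pgl2_sq_def)
    moreover from this z(2) have "sym2 x0 \<noteq> 1\<^sub>m 3 \<or> sym2 y0 \<noteq> 1\<^sub>m 3" by (auto simp: emb_def)
    ultimately obtain e x y where xy: "x \<in> SL2" "y \<in> SL2" "z = emb_at e x y" "sym2 x \<noteq> 1\<^sub>m 3"
      unfolding emb_at_def by metis
    obtain g a b d where g: "g \<in> SL2" "sl_mult (sl_mult g x) (sl_inv g) = Q a b 0 d"
      using SL2_triangular_conjugate[OF xy(1)] by blast
    let ?x = "sl_mult (sl_mult g x) (sl_inv g)"
    have xS: "?x \<in> SL2" by (intro SL2_mult SL2_inv g(1) xy(1))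
    have zN: "emb_at e ?x y \<in> N"
      using conjN[OF emb_at_in_pgl2_sq[OF g(1) SL2_closed(1)], of z e] z(1) g(1) xy
      by (simp add: emb_at_conj)
    have nc: "sym2 ?x \<noteq> 1\<^sub>m 3"
    proof
      assume *: "sym2 ?x = 1\<^sub>m 3"
      have gi: "sym2 (sl_inv g) * sym2 g = 1\<^sub>m 3" "sym2 g * sym2 (sl_inv g) = 1\<^sub>m 3"
        using g(1) by (simp_all flip: sym2_mult)
      have "sym2 x = sym2 (sl_inv g) * sym2 g * sym2 x * (sym2 (sl_inv g) * sym2 g)"
        by (simp add: gi)
      also have "\<dots> = sym2 (sl_inv g) * sym2 ?x * sym2 g"
        unfolding sym2_mult
        by (simp add: assoc_mult_mat[of _ 3 3 _ 3 _ 3] mult_carrier_mat[of _ 3 3 _ 3])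
      also have "\<dots> = 1\<^sub>m 3" by (simp add: * gi)
      finally show False using xy(4) by simp
    qed
    obtain h r where h: "h \<in> SL2" "r \<noteq> 0" "sl_mult ?x (sl_mult (sl_mult h (sl_inv ?x)) (sl_inv h)) = up r"
      using commutator_transvection[OF g(2) xS nc] by blast
    have "emb_at e (sl_inv ?x) (sl_inv y) \<in> N"
      using subgroup.m_inv_closed[OF N zN] emb_at_inv[OF xS xy(2)] by metis
    from conjN[OF emb_at_in_pgl2_sq[OF h(1) SL2_closed(1), of e] this]
    have "emb_at e (sl_mult (sl_mult h (sl_inv ?x)) (sl_inv h)) (sl_inv y) \<in> N"
      using h(1) by (simp add: emb_at_conj del: sl_inv.simps sl_mult.simps)
    from multN[OF zN this] have r: "emb_at e (up r) sl_one \<in> N"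
      using xy(2) h(3) by (simp add: emb_at_simps)
    have "SL2 \<subseteq> {x. emb_at e x sl_one \<in> N}"
    proof (rule SL2_normal_closure[of _ r])
      fix g x :: "'k quad" assume "g \<in> SL2" "x \<in> {x. emb_at e x sl_one \<in> N}"
      then show "sl_mult (sl_mult g x) (sl_inv g) \<in> {x. emb_at e x sl_one \<in> N}"
        using conjN[OF emb_at_in_pgl2_sq[of g sl_one e], of "emb_at e x sl_one"] by (simp add: emb_at_conj)
    next
      fix x y :: "'k quad" assume "x \<in> {x. emb_at e x sl_one \<in> N}" "y \<in> {x. emb_at e x sl_one \<in> N}"
      then show "sl_mult x y \<in> {x. emb_at e x sl_one \<in> N}"
        using multN by (fastforce simp: emb_at_simps)
    qed (use oneN r h(2) in \<open>simp_all add: emb_at_simps\<close>)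
    then show False using solvable_no_factor[OF N sol, of e] by blast
  qed
qed

section \<open>A maximal torus\<close>

text \<open>
  These are the matrices \<open>emb (dg a) (dg b)\<close> in the parameters \<open>s = a\<^sup>2\<close> and \<open>t = b\<^sup>2\<close>, which unlike
  \<open>a\<close> and \<open>b\<close> are coordinates on the torus.
\<close>

definition tor :: "'k::field \<Rightarrow> 'k \<Rightarrow> 'k mat" where
  "tor s t = mat 6 6 (\<lambda>(i, j). if i = j then [s, 1, inverse s, t, 1, inverse t] ! i else 0)"

definition max_torus :: "'k::field mat set" where
  "max_torus = {tor s t | s t. s \<noteq> 0 \<and> t \<noteq> 0}"

lemma tor_index:
  "i < 6 \<Longrightarrow> j < 6 \<Longrightarrow> tor s t $$ (i, j) = (if i = j then [s, 1, inverse s, t, 1, inverse t] ! i else 0)"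
  by (simp add: tor_def)

lemma tor_in: "s \<noteq> 0 \<Longrightarrow> t \<noteq> 0 \<Longrightarrow> tor s t \<in> max_torus"
  by (auto simp: max_torus_def)

lemma less_6_cases: "(i::nat) < 6 \<Longrightarrow> i = 0 \<or> i = 1 \<or> i = 2 \<or> i = 3 \<or> i = 4 \<or> i = 5" by auto

lemma sym2_dg:
  assumes "a \<noteq> 0" "i < 3" "j < 3"
  shows "sym2 (dg a) $$ (i, j) = (if i = j then [a * a, 1, inverse (a * a)] ! i else 0)"
  using less_3_cases[OF assms(2)] less_3_cases[OF assms(3)] assms(1) unfolding dg_def
  by (elim disjE) (simp_all add: sym2_index sym2_index[unfolded One_nat_def] del: sym2.simps)

lemma emb_dg:
  assumes "a \<noteq> 0" "b \<noteq> 0" shows "emb (dg a) (dg b) = tor (a * a) (b * b)"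
proof (rule eq_matI)
  fix i j assume "i < dim_row (tor (a * a) (b * b))" "j < dim_col (tor (a * a) (b * b))"
  then have ij: "i < 6" "j < 6" by (simp_all add: tor_def)
  consider "i < 3" "j < 3" | "3 \<le> i" "3 \<le> j" | "i < 3 \<longleftrightarrow> 3 \<le> j" by linarith
  then show "emb (dg a) (dg b) $$ (i, j) = tor (a * a) (b * b) $$ (i, j)"
  proof cases
    case 1
    then show ?thesis using ij less_3_cases[of i] by (auto simp: emb_index tor_index sym2_dg assms)
  next
    case 2
    then have "i - 3 < 3" "j - 3 < 3" "i - 3 = j - 3 \<longleftrightarrow> i = j" using ij by auto
    with 2 have "emb (dg a) (dg b) $$ (i, j) = (if i = j then [b * b, 1, inverse (b * b)] ! (i - 3) else 0)"
      using ij by (simp add: emb_index sym2_dg assms)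
    also have "\<dots> = tor (a * a) (b * b) $$ (i, j)"
      using less_6_cases[OF ij(1)] 2(1) ij by (auto simp: tor_index)
    finally show ?thesis .
  qed (use ij in \<open>auto simp: emb_index tor_index\<close>)
qed (simp_all add: tor_def)

lemma tor_obtain:
  fixes s t :: "'k::alg_closed_field"
  assumes "s \<noteq> 0" "t \<noteq> 0"
  obtains a b where "a \<noteq> 0" "b \<noteq> 0" "s = a * a" "t = b * b" "tor s t = emb (dg a) (dg b)"
proof -
  obtain a b where ab: "a ^ 2 = s" "b ^ 2 = t" using nth_root_exists[of 2] by (metis zero_less_numeral)
  then have "a \<noteq> 0" "b \<noteq> 0" using assms by auto
  then show thesis using that[of a b] ab emb_dg[of a b] by (simp add: power2_eq_square)
qed

lemma max_torus_eq:
  "(max_torus :: 'k::alg_closed_field mat set) = {emb (dg a) (dg b) | a b. a \<noteq> 0 \<and> b \<noteq> 0}"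
proof (rule subset_antisym; rule subsetI)
  fix z :: "'k mat" assume "z \<in> max_torus"
  then obtain s t where st: "s \<noteq> 0" "t \<noteq> 0" "z = tor s t" by (auto simp: max_torus_def)
  obtain a b where "a \<noteq> 0" "b \<noteq> 0" "tor s t = emb (dg a) (dg b)" using tor_obtain[OF st(1,2)] .
  with st(3) show "z \<in> {emb (dg a) (dg b) | a b. a \<noteq> 0 \<and> b \<noteq> 0}" by blast
next
  fix z :: "'k mat" assume "z \<in> {emb (dg a) (dg b) | a b. a \<noteq> 0 \<and> b \<noteq> 0}"
  then obtain a b where "a \<noteq> 0" "b \<noteq> 0" "z = emb (dg a) (dg b)" by blast
  then show "z \<in> max_torus" using tor_in[of "a * a" "b * b"] by (simp add: emb_dg)
qed

lemma max_torus_sub: "(max_torus :: 'k::alg_closed_field mat set) \<subseteq> pgl2_sq"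
  unfolding max_torus_eq by auto

lemma tor_mult:
  fixes s t :: "'k::alg_closed_field"
  assumes "s \<noteq> 0" "t \<noteq> 0" "s' \<noteq> 0" "t' \<noteq> 0"
  shows "tor s t * tor s' t' = tor (s * s') (t * t')"
proof -
  obtain a b where ab: "a \<noteq> 0" "b \<noteq> 0" "s = a * a" "t = b * b" "tor s t = emb (dg a) (dg b)"
    using tor_obtain[OF assms(1,2)] .
  obtain a' b' where ab': "a' \<noteq> 0" "b' \<noteq> 0" "s' = a' * a'" "t' = b' * b'" "tor s' t' = emb (dg a') (dg b')"
    using tor_obtain[OF assms(3,4)] .
  have dg: "sl_mult (dg x) (dg y) = dg (x * y)" for x y :: 'k by (simp add: dg_def mult.commute)
  show ?thesis
    using emb_dg[of "a * a'" "b * b'"] ab ab' by (simp add: emb_mult dg mult_ac)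
qed

lemma det_tor: "s \<noteq> 0 \<Longrightarrow> t \<noteq> 0 \<Longrightarrow> det (tor s t :: 'k::alg_closed_field mat) = 1"
  using tor_obtain[of s t] det_emb SL2_closed(4) by metis

lemma tor_one: "tor 1 1 = (1\<^sub>m 6 :: 'k::field mat)"
proof (rule eq_matI)
  fix i j assume "i < dim_row (1\<^sub>m 6 :: 'k mat)" "j < dim_col (1\<^sub>m 6 :: 'k mat)"
  then have ij: "i < 6" "j < 6" by simp_all
  then show "tor 1 1 $$ (i, j) = (1\<^sub>m 6 :: 'k mat) $$ (i, j)"
    using less_6_cases[OF ij(1)] by (auto simp: tor_index)
qed (simp_all add: tor_def)

lemma subgroup_max_torus: "subgroup (max_torus :: 'k::alg_closed_field mat set) (GL 6)"
proof (rule group.subgroupI[OF group_GL])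
  show "(max_torus :: 'k mat set) \<subseteq> carrier (GL 6)"
    using max_torus_sub subgroup.subset[OF subgroup_pgl2_sq] by (rule subset_trans)
  show "(max_torus :: 'k mat set) \<noteq> {}" using tor_in[of 1 1] by auto
  fix z :: "'k mat" assume "z \<in> max_torus"
  then obtain s t where st: "s \<noteq> 0" "t \<noteq> 0" "z = tor s t" by (auto simp: max_torus_def)
  have "inv\<^bsub>GL 6\<^esub> z = tor (inverse s) (inverse t)"
    unfolding st(3)
    by (rule GL_I(2)) (use st tor_mult[of s t "inverse s" "inverse t"] tor_mult[of "inverse s" "inverse t" s t] in
      \<open>auto simp: tor_def[of s t] tor_def[of "inverse s" "inverse t"] tor_one\<close>)
  then show "inv\<^bsub>GL 6\<^esub> z \<in> max_torus" using st by (simp add: tor_in)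
  fix z' :: "'k mat" assume "z' \<in> max_torus"
  then obtain s' t' where "s' \<noteq> 0" "t' \<noteq> 0" "z' = tor s' t'" by (auto simp: max_torus_def)
  with st show "z \<otimes>\<^bsub>GL 6\<^esub> z' \<in> max_torus" by (simp add: tor_mult tor_in)
qed

lemma SL2_diagonal:
  assumes "x \<in> SL2" "\<And>i j. i < 3 \<Longrightarrow> j < 3 \<Longrightarrow> i \<noteq> j \<Longrightarrow> sym2 x $$ (i, j) = 0"
  shows "\<exists>a. a \<noteq> 0 \<and> x = dg a"
proof -
  obtain a b c d where x: "x = Q a b c d" by (cases x)
  have "b = 0" "c = 0" using assms(2)[of 0 2] assms(2)[of 2 0] unfolding x sym2_index by simp_all
  moreover from this have ad: "a * d = 1" using assms(1) by (simp add: x SL2_def)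
  then have "a \<noteq> 0" by auto
  then have "d = inverse a" using ad inverse_unique by metis
  ultimately show ?thesis using \<open>a \<noteq> 0\<close> by (auto simp: x dg_def)
qed

lemma max_torus_eq_diagonal:
  "(max_torus :: 'k::alg_closed_field mat set) =
    pgl2_sq \<inter> {A \<in> carrier (GL 6). \<forall>i<6. \<forall>j<6. i \<noteq> j \<longrightarrow> A $$ (i, j) = 0}" (is "?T = _ \<inter> ?D")
proof (rule subset_antisym; rule subsetI)
  fix z :: "'k mat" assume z: "z \<in> max_torus"
  then have "z \<in> carrier (GL 6)" using subgroup.subset[OF subgroup_max_torus] by blast
  moreover have "\<forall>i<6. \<forall>j<6. i \<noteq> j \<longrightarrow> z $$ (i, j) = 0" using z by (auto simp: max_torus_def tor_index)
  ultimately show "z \<in> pgl2_sq \<inter> ?D" using z max_torus_sub by blast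
next
  fix z :: "'k mat" assume z: "z \<in> pgl2_sq \<inter> ?D"
  then obtain x y where xy: "x \<in> SL2" "y \<in> SL2" "z = emb x y" by (auto simp: pgl2_sq_def)
  have off: "emb x y $$ (i, j) = 0" if "i < 6" "j < 6" "i \<noteq> j" for i j using z that unfolding xy(3) by simp
  obtain a where a: "a \<noteq> 0" "x = dg a"
  proof -
    have "sym2 x $$ (i, j) = 0" if "i < 3" "j < 3" "i \<noteq> j" for i j
      using off[of i j] that by (simp add: emb_index)
    then show thesis using SL2_diagonal[OF xy(1)] that by blast
  qed
  obtain b where b: "b \<noteq> 0" "y = dg b"
  proof -
    have "sym2 y $$ (i, j) = 0" if "i < 3" "j < 3" "i \<noteq> j" for i j
      using off[of "i + 3" "j + 3"] that by (simp add: emb_index)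
    then show thesis using SL2_diagonal[OF xy(2)] that by blast
  qed
  show "z \<in> max_torus" unfolding max_torus_eq using a b xy by blast
qed

lemma closedin_max_torus: "closedin (zariski 6) (max_torus :: 'k::alg_closed_field mat set)"
  unfolding max_torus_eq_diagonal
proof (intro closedin_Int closedin_pgl2_sq closedin_zariskiI)
  let ?X = "carrier (GL 6) :: 'k mat set"
  fix A :: "'k mat" assume "A \<in> ?X"
    and van: "\<And>f. fun_on ?X f \<in> regular_functions 6 ?X \<Longrightarrow>
      (\<And>x. x \<in> {A \<in> ?X. \<forall>i<6. \<forall>j<6. i \<noteq> j \<longrightarrow> A $$ (i, j) = 0} \<Longrightarrow> f x = 0) \<Longrightarrow> f A = 0"
  moreover have "A $$ (i, j) = 0" if "i < 6" "j < 6" "i \<noteq> j" for i j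
    by (rule van) (use that in \<open>auto intro: reg_entry\<close>)
  ultimately show "A \<in> {A \<in> ?X. \<forall>i<6. \<forall>j<6. i \<noteq> j \<longrightarrow> A $$ (i, j) = 0}" by simp
qed auto

definition d2 :: "'k::field \<Rightarrow> 'k \<Rightarrow> 'k mat" where
  "d2 s t = mat 2 2 (\<lambda>(i, j). if i = j then [s, t] ! i else 0)"

abbreviation diag2 :: "'k::field mat set" where
  "diag2 \<equiv> {A \<in> carrier (GL 2). diagonal_mat A}"

lemma less_2_cases': "(i::nat) < 2 \<Longrightarrow> i = 0 \<or> i = 1" by auto

lemma d2_mult: "d2 s t * d2 s' t' = d2 (s * s') (t * t')"
proof (rule eq_matI)
  fix i j assume "i < dim_row (d2 (s * s') (t * t'))" "j < dim_col (d2 (s * s') (t * t'))"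
  then have "i < 2" "j < 2" by (simp_all add: d2_def)
  then show "(d2 s t * d2 s' t') $$ (i, j) = d2 (s * s') (t * t') $$ (i, j)"
    using less_2_cases'[of i] less_2_cases'[of j]
    by (auto simp: d2_def scalar_prod_def numeral_2_eq_2)
qed (simp_all add: d2_def)

lemma det_d2: "det (d2 s t) = s * t"
proof -
  have "upper_triangular (d2 s t)" by (rule upper_triangularI) (auto simp: d2_def)
  then show ?thesis
    by (subst det_upper_triangular[of _ 2]) (auto simp: d2_def diag_mat_def numeral_2_eq_2)
qed

lemma d2_one: "d2 1 1 = 1\<^sub>m 2"
  by (rule eq_matI) (auto simp: d2_def dest!: less_2_cases')

lemma diag2_eq: "(diag2 :: 'k::field mat set) = {d2 s t | s t. s \<noteq> 0 \<and> t \<noteq> 0}"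
proof (rule subset_antisym; rule subsetI)
  fix A :: "'k mat" assume A: "A \<in> diag2"
  then have c: "A \<in> carrier_mat 2 2" by (simp add: GL_carrier_mat)
  have "A = d2 (A $$ (0, 0)) (A $$ (1, 1))"
  proof (rule eq_matI)
    fix i j assume "i < dim_row (d2 (A $$ (0, 0)) (A $$ (1, 1)))" "j < dim_col (d2 (A $$ (0, 0)) (A $$ (1, 1)))"
    then have ij: "i < 2" "j < 2" by (simp_all add: d2_def)
    then have "A $$ (i, j) = 0" if "i \<noteq> j" using that A c by (auto simp: diagonal_mat_def)
    with ij show "A $$ (i, j) = d2 (A $$ (0, 0)) (A $$ (1, 1)) $$ (i, j)"
      using less_2_cases'[OF ij(1)] by (auto simp: d2_def)
  qed (use c in \<open>auto simp: d2_def\<close>)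
  moreover from this have "A $$ (0, 0) * A $$ (1, 1) \<noteq> 0" using det_d2 GL_det_nz[of A 2] A by (metis mem_Collect_eq)
  ultimately show "A \<in> {d2 s t | s t. s \<noteq> 0 \<and> t \<noteq> 0}" by (metis (mono_tags, lifting) mem_Collect_eq mult_eq_0_iff)
next
  fix A :: "'k mat" assume "A \<in> {d2 s t | s t. s \<noteq> 0 \<and> t \<noteq> 0}"
  then obtain s t where st: "s \<noteq> 0" "t \<noteq> 0" "A = d2 s t" by blast
  have "d2 s t \<in> carrier (GL 2)"
    by (rule GL_I(1)[of _ _ "d2 (inverse s) (inverse t)"]) (use st in \<open>simp_all add: d2_mult d2_one\<close>, simp_all add: d2_def)
  then show "A \<in> diag2" by (auto simp: st(3) diagonal_mat_def d2_def)
qed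

definition torus_coord :: "'k::field mat \<Rightarrow> 'k mat" where
  "torus_coord x = d2 (x $$ (0, 0)) (x $$ (3, 3))"

lemma torus_coord_tor: "torus_coord (tor s t) = d2 s t"
  by (simp add: torus_coord_def tor_index)

lemma d2_inj: "d2 s t = d2 s' t' \<longleftrightarrow> s = s' \<and> t = t'"
proof
  assume *: "d2 s t = d2 s' t'"
  have "d2 s t $$ (0, 0) = s" "d2 s t $$ (1, 1) = t" for s t :: 'a by (simp_all add: d2_def)
  with * show "s = s' \<and> t = t'" by metis
qed simp

lemma bij_torus_coord: "bij_betw torus_coord max_torus diag2"
  unfolding diag2_eq max_torus_def bij_betw_def
proof
  show "inj_on torus_coord {tor s t |s t. s \<noteq> 0 \<and> t \<noteq> 0}"
    by (rule inj_onI) (auto simp: torus_coord_tor d2_inj)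
  show "torus_coord ` {tor s t |s t. s \<noteq> 0 \<and> t \<noteq> 0} = {d2 s t |s t. s \<noteq> 0 \<and> t \<noteq> 0}"
  proof (rule subset_antisym; rule subsetI)
    fix A assume "A \<in> torus_coord ` {tor s t |s t. s \<noteq> 0 \<and> t \<noteq> 0}"
    then obtain s t where "s \<noteq> 0" "t \<noteq> 0" "A = torus_coord (tor s t)" by blast
    then show "A \<in> {d2 s t |s t. s \<noteq> 0 \<and> t \<noteq> 0}" unfolding torus_coord_tor by blast
  next
    fix A assume "A \<in> {d2 s t |s t. s \<noteq> 0 \<and> t \<noteq> 0}"
    then obtain s t where "s \<noteq> 0" "t \<noteq> 0" "A = torus_coord (tor s t)" unfolding torus_coord_tor by blast
    then show "A \<in> torus_coord ` {tor s t |s t. s \<noteq> 0 \<and> t \<noteq> 0}" by blast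
  qed
qed

lemma inv_torus_coord: "s \<noteq> 0 \<Longrightarrow> t \<noteq> 0 \<Longrightarrow> inv_into max_torus torus_coord (d2 s t) = tor s t"
  by (rule inv_into_f_eq[OF bij_betw_imp_inj_on[OF bij_torus_coord] tor_in torus_coord_tor])

lemma torus_iso: "alg_group_iso 6 (max_torus :: 'k::alg_closed_field mat set) 2 diag2 torus_coord"
  unfolding alg_group_iso_def
proof (intro conjI ballI)
  let ?T = "max_torus :: 'k mat set"
  have "torus_coord \<in> hom (subgrp 6 ?T) (subgrp 2 diag2)"
  proof (rule homI)
    fix x assume "x \<in> carrier (subgrp 6 ?T)"
    then show "torus_coord x \<in> carrier (subgrp 2 diag2)"
      using bij_betwE[OF bij_torus_coord] by auto
  next
    fix x y assume "x \<in> carrier (subgrp 6 ?T)" "y \<in> carrier (subgrp 6 ?T)"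
    then show "torus_coord (x \<otimes>\<^bsub>subgrp 6 ?T\<^esub> y) = torus_coord x \<otimes>\<^bsub>subgrp 2 diag2\<^esub> torus_coord y"
      by (auto simp: max_torus_def tor_mult torus_coord_tor d2_mult)
  qed
  then show "torus_coord \<in> iso (subgrp 6 ?T) (subgrp 2 diag2)"
    using bij_torus_coord by (simp add: iso_def)
  {
    fix f :: "'k mat \<Rightarrow> 'k" assume f: "f \<in> regular_functions 2 diag2"
    have "fun_on ?T (\<lambda>x. f (torus_coord x)) \<in> regular_functions 6 ?T"
    proof (rule regular_comp[OF f])
      show "torus_coord x \<in> diag2" if "x \<in> ?T" for x
        using bij_betwE[OF bij_torus_coord] that by blast
      fix i j :: nat assume ij: "i < 2" "j < 2"
      have "(\<lambda>x :: 'k mat. torus_coord x $$ (i, j)) = (\<lambda>x. if i = j then if i = 0 then x $$ (0, 0) else x $$ (3, 3) else 0)"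
        using ij less_2_cases'[of i] by (auto simp: torus_coord_def d2_def)
      then show "fun_on ?T (\<lambda>x. torus_coord x $$ (i, j)) \<in> regular_functions 6 ?T"
        by (cases "i = j"; cases "i = 0") (simp_all add: reg_const reg_entry)
    next
      have "fun_on ?T (\<lambda>x. inverse (det (torus_coord x))) = fun_on ?T (\<lambda>x. x $$ (2, 2) * x $$ (5, 5))"
        by (rule fun_on_cong) (auto simp: max_torus_def torus_coord_tor det_d2 tor_index)
      then show "fun_on ?T (\<lambda>x. inverse (det (torus_coord x))) \<in> regular_functions 6 ?T"
        by (simp add: reg_mult reg_entry)
    qed
    then show "fun_on ?T (f \<circ> torus_coord) \<in> regular_functions 6 ?T" by (simp add: comp_def)
  next
    fix f :: "'k mat \<Rightarrow> 'k" assume f: "f \<in> regular_functions 6 ?T"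
    let ?\<psi> = "inv_into ?T torus_coord"
    have "fun_on diag2 (\<lambda>x. f (?\<psi> x)) \<in> regular_functions 2 diag2"
    proof (rule regular_comp[OF f])
      show "?\<psi> x \<in> ?T" if "x \<in> diag2" for x
        using that bij_betwE[OF bij_betw_inv_into[OF bij_torus_coord]] by blast
      fix i j :: nat assume ij: "i < 6" "j < 6"
      let ?e = "\<lambda>A :: 'k mat. [A $$ (0, 0), 1, A $$ (1, 1) * inverse (det A), A $$ (1, 1), 1, A $$ (0, 0) * inverse (det A)]"
      have eq: "fun_on diag2 (\<lambda>x. ?\<psi> x $$ (i, j)) = fun_on diag2 (\<lambda>A. if i = j then ?e A ! i else 0)"
      proof (rule fun_on_cong)
        fix A :: "'k mat" assume "A \<in> diag2"
        then obtain s t where st: "s \<noteq> 0" "t \<noteq> 0" "A = d2 s t" unfolding diag2_eq by blast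
        have eA: "?e A = [s, 1, inverse s, t, 1, inverse t]"
          unfolding st(3) det_d2 using st(1,2) by (simp add: d2_def field_simps)
        then show "?\<psi> A $$ (i, j) = (if i = j then ?e A ! i else 0)"
          unfolding eA using ij st by (simp add: inv_torus_coord tor_index)
      qed
      have "fun_on diag2 (\<lambda>A. ?e A ! i) \<in> regular_functions 2 diag2"
        using less_6_cases[OF ij(1)]
        by (elim disjE) (simp_all add: reg_const reg_entry reg_mult reg_inv_det)
      then show "fun_on diag2 (\<lambda>x. ?\<psi> x $$ (i, j)) \<in> regular_functions 2 diag2"
        unfolding eq by (cases "i = j") (simp_all add: reg_const)
    next
      have "fun_on diag2 (\<lambda>x. inverse (det (?\<psi> x))) = fun_on diag2 (\<lambda>_. 1)"
      proof (rule fun_on_cong)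
        fix A :: "'k mat" assume "A \<in> diag2"
        then obtain s t where "s \<noteq> 0" "t \<noteq> 0" "A = d2 s t" unfolding diag2_eq by blast
        then show "inverse (det (?\<psi> A)) = 1" by (simp add: inv_torus_coord det_tor)
      qed
      then show "fun_on diag2 (\<lambda>x. inverse (det (?\<psi> x))) \<in> regular_functions 2 diag2"
        by (simp add: reg_const)
    qed
    then show "fun_on diag2 (f \<circ> ?\<psi>) \<in> regular_functions 2 diag2" by (simp add: comp_def)
  }
qed

lemma diagonal_mat_commute:
  fixes A B :: "'a::comm_semiring_0 mat"
  assumes "A \<in> carrier_mat n n" "B \<in> carrier_mat n n" "diagonal_mat A" "diagonal_mat B"
  shows "A * B = B * A"
proof (rule eq_matI)
  fix i j assume "i < dim_row (B * A)" "j < dim_col (B * A)"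
  then have ij: "i < n" "j < n" using assms by simp_all
  have "A $$ (i, l) * B $$ (l, j) = B $$ (i, l) * A $$ (l, j)" if "l < n" for l
    using that ij assms by (cases "l = i"; cases "l = j") (auto simp: diagonal_mat_def mult.commute)
  then show "(A * B) $$ (i, j) = (B * A) $$ (i, j)"
    using ij assms(1,2) by (simp add: scalar_prod_def)
qed (use assms in auto)

lemma torus_commute:
  assumes "torus n T" "x \<in> T" "y \<in> T" shows "x * y = y * x"
proof -
  obtain r \<phi> where iso: "alg_group_iso n T r {A \<in> carrier (GL r). diagonal_mat A} \<phi>"
    and T: "subgroup T (GL n)" using assms(1) by (auto simp: torus_def linear_algebraic_group_def)
  then have hom: "\<phi> \<in> hom (subgrp n T) (subgrp r {A \<in> carrier (GL r). diagonal_mat A})"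
    and inj: "inj_on \<phi> T" by (auto simp: alg_group_iso_def iso_def bij_betw_def)
  have D: "\<phi> z \<in> carrier_mat r r" "diagonal_mat (\<phi> z)" if "z \<in> T" for z
    using hom_in_carrier[OF hom, of z] that by (auto simp: GL_carrier_mat)
  have "\<phi> x * \<phi> y = \<phi> y * \<phi> x"
    by (intro diagonal_mat_commute[where n = r] D assms)
  have xy: "x * y \<in> T" "y * x \<in> T" using subgroup.m_closed[OF T] assms(2,3) by auto
  have "\<phi> (x * y) = \<phi> (y * x)"
    using hom_mult[OF hom, of x y] hom_mult[OF hom, of y x] assms(2,3) \<open>\<phi> x * \<phi> y = \<phi> y * \<phi> x\<close> by simp
  then show ?thesis using inj xy by (auto dest: inj_onD)
qed

text \<open>
  A torus is commutative, so maximality follows once the centraliser in \<open>G\<close> is the torus itself.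
  Commuting with a single diagonal element suffices, provided that its entries within each block are
  distinct.
\<close>

lemma centraliser_max_torus:
  fixes z :: "'k::alg_closed_field mat"
  assumes z: "z \<in> pgl2_sq" and comm: "\<And>t. t \<in> max_torus \<Longrightarrow> z * t = t * z"
  shows "z \<in> max_torus"
proof -
  obtain x y where xy: "z = emb x y" using z by (auto simp: pgl2_sq_def)
  obtain u :: 'k where u: "u \<noteq> 0" "u * u \<noteq> 1" using ex_square_neq_1 by blast
  let ?e = "\<lambda>i. [u, 1, inverse u, u, 1, inverse u] ! i"
  have zc: "z \<in> carrier_mat 6 6" by (simp add: xy)
  have "z $$ (i, j) = 0" if ij: "i < 6" "j < 6" "i \<noteq> j" for i j
  proof (cases "i < 3 \<longleftrightarrow> j < 3")
    case True
    have "(\<Sum>l = 0..<6. z $$ (i, l) * tor u u $$ (l, j)) = z $$ (i, j) * ?e j"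
      using ij by (subst sum.remove[of _ j]) (auto intro!: sum.neutral simp: tor_index)
    then have 1: "(z * tor u u) $$ (i, j) = z $$ (i, j) * ?e j"
      using ij zc by (simp add: scalar_prod_def tor_def[of u u])
    have "(\<Sum>l = 0..<6. tor u u $$ (i, l) * z $$ (l, j)) = ?e i * z $$ (i, j)"
      using ij by (subst sum.remove[of _ i]) (auto intro!: sum.neutral simp: tor_index)
    then have 2: "(tor u u * z) $$ (i, j) = ?e i * z $$ (i, j)"
      using ij zc by (simp add: scalar_prod_def tor_def[of u u])
    have "z $$ (i, j) * ?e j = ?e i * z $$ (i, j)"
      using comm[OF tor_in[OF u(1) u(1)]] 1 2 by (simp only:)
    then have "z $$ (i, j) * (?e j - ?e i) = 0"
      by (simp only: right_diff_distrib mult.commute[of "?e i"] diff_self)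
    moreover have "u \<noteq> 1" "inverse u \<noteq> 1" "inverse u \<noteq> u"
      using u by (auto simp: inverse_eq_1_iff dest: right_inverse)
    then have "?e j \<noteq> ?e i"
      using less_6_cases[OF ij(1)] less_6_cases[OF ij(2)] ij(3) True by (elim disjE) auto
    ultimately show ?thesis by simp
  qed (use ij in \<open>auto simp: xy emb_index\<close>)
  then show ?thesis
    unfolding max_torus_eq_diagonal using z subgroup.subset[OF subgroup_pgl2_sq] by blast
qed

lemma maximal_torus_max_torus: "maximal_torus 6 pgl2_sq (max_torus :: 'k::alg_closed_field mat set)"
  unfolding maximal_torus_def
proof (intro conjI allI impI max_torus_sub)
  show "torus 6 (max_torus :: 'k mat set)"
    unfolding torus_def linear_algebraic_group_def
    using subgroup_max_torus closedin_max_torus torus_iso by blast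
  fix T' :: "'k mat set" assume T': "torus 6 T' \<and> max_torus \<subseteq> T' \<and> T' \<subseteq> pgl2_sq"
  have "z \<in> max_torus" if "z \<in> T'" for z
    using T' that torus_commute[of 6 T' z] by (intro centraliser_max_torus) auto
  with T' show "T' = max_torus" by blast
qed

section \<open>The character lattice\<close>

definition chr :: "int \<Rightarrow> int \<Rightarrow> 'k::field mat \<Rightarrow> 'k" where
  "chr i j = fun_on max_torus (\<lambda>x. x $$ (0, 0) powi i * x $$ (3, 3) powi j)"

lemma chr_tor: "s \<noteq> 0 \<Longrightarrow> t \<noteq> 0 \<Longrightarrow> chr i j (tor s t) = s powi i * t powi j"
  by (simp add: chr_def fun_on_apply tor_in tor_index)

lemma eq_on_max_torus:
  assumes "fun_on max_torus f = f" "fun_on max_torus g = g"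
    and "\<And>s t. s \<noteq> 0 \<Longrightarrow> t \<noteq> 0 \<Longrightarrow> f (tor s t) = g (tor s t)"
  shows "f = g"
proof -
  have "fun_on max_torus f = fun_on max_torus g"
    by (rule fun_on_cong) (auto simp: max_torus_def assms(3))
  then show ?thesis using assms(1,2) by simp
qed

lemma fun_on_chr: "fun_on max_torus (chr i j) = chr i j"
  by (auto simp: chr_def fun_on_def)

lemma chr_mult: "chr i j * chr i' j' = (chr (i + i') (j + j') :: 'k::field mat \<Rightarrow> 'k)"
proof (rule eq_on_max_torus)
  show "fun_on max_torus (chr i j * chr i' j') = (chr i j * chr i' j' :: 'k mat \<Rightarrow> 'k)"
    by (auto simp: chr_def fun_on_def)
qed (simp_all add: fun_on_chr chr_tor power_int_add)

lemma chr_one: "chr 0 0 = fun_on max_torus (\<lambda>_. 1)"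
  by (simp add: chr_def)

lemma reg_chr: "chr i j \<in> regular_functions 6 (max_torus :: 'k::field mat set)"
proof -
  let ?T = "max_torus :: 'k mat set"
  have *: "fun_on ?T (\<lambda>x. x $$ (k, k) powi i) \<in> regular_functions 6 ?T" if k: "k = 0 \<or> k = 3" for k i
  proof (cases "i \<ge> 0")
    case True
    then show ?thesis unfolding power_int_def if_P[OF True] by (intro reg_power reg_entry) (use k in auto)
  next
    case False
    have "fun_on ?T (\<lambda>x. x $$ (k, k) powi i) = fun_on ?T (\<lambda>x. x $$ (k + 2, k + 2) ^ nat (- i))"
      by (rule fun_on_cong) (use k False in \<open>auto simp: max_torus_def tor_index power_int_def\<close>)
    moreover have "fun_on ?T (\<lambda>x. x $$ (k + 2, k + 2) ^ nat (- i)) \<in> regular_functions 6 ?T"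
      by (intro reg_power reg_entry) (use k in auto)
    ultimately show ?thesis by simp
  qed
  show ?thesis unfolding chr_def by (intro reg_mult *) auto
qed

text \<open>
  Each entry of \<open>tor\<close> on a coordinate axis is \<open>0\<close>, \<open>1\<close>, \<open>s\<close> or \<open>1/s\<close>, and a power of \<open>s\<close> clears the
  denominators that sums and products of such entries accumulate.
\<close>

lemma torus_curve_laurent:
  fixes f :: "'k::alg_closed_field mat \<Rightarrow> 'k"
  assumes f: "f \<in> regular_functions 6 max_torus" and c: "c = (\<lambda>s. tor s 1) \<or> c = tor 1"
  shows "\<exists>m p. \<forall>s. s \<noteq> 0 \<longrightarrow> f (c s) * s ^ m = poly p s"
proof -
  have cT: "c s \<in> max_torus" if "s \<noteq> 0" for s using c that by (auto simp: tor_in)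
  show ?thesis
    using f
  proof (induction rule: regular_induct)
    case (const d)
    show ?case by (intro exI[of _ 0] exI[of _ "[:d:]"]) (simp add: fun_on_apply cT)
  next
    case (entry i j)
    have "\<exists>p. \<forall>s. s \<noteq> 0 \<longrightarrow> c s $$ (i, j) * s = poly p s"
    proof (cases "i = j")
      case True
      have "\<exists>p. \<forall>s. s \<noteq> 0 \<longrightarrow> x s * s = poly p s"
        if "x = (\<lambda>s. s) \<or> x = (\<lambda>_. 1) \<or> x = inverse" for x :: "'k \<Rightarrow> 'k"
        using that
      proof (elim disjE)
        show ?thesis if "x = (\<lambda>s. s)" by (rule exI[of _ "[:0, 0, 1:]"]) (simp add: that)
        show ?thesis if "x = (\<lambda>_. 1)" by (rule exI[of _ "[:0, 1:]"]) (simp add: that)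
        show ?thesis if "x = inverse" by (rule exI[of _ "[:1:]"]) (simp add: that)
      qed
      moreover have "(\<lambda>s. c s $$ (i, j)) = (\<lambda>s. s) \<or> (\<lambda>s. c s $$ (i, j)) = (\<lambda>_. 1) \<or> (\<lambda>s. c s $$ (i, j)) = inverse"
        using c less_6_cases[OF entry(1)] entry True by (elim disjE) (simp_all add: tor_index)
      ultimately show ?thesis by blast
    next
      case False
      then show ?thesis using c entry by (intro exI[of _ 0]) (auto simp: tor_index)
    qed
    then obtain p where p: "\<forall>s. s \<noteq> 0 \<longrightarrow> c s $$ (i, j) * s = poly p s" by blast
    then show ?case by (intro exI[of _ 1] exI[of _ p]) (simp add: fun_on_apply cT)
  next
    case inv_det
    have "det (c s) = 1" if "s \<noteq> 0" for s using c that by (auto simp: det_tor)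
    then show ?case by (intro exI[of _ 0] exI[of _ 1]) (simp add: fun_on_apply cT)
  next
    case (add f g)
    then obtain m p m' p' where
      "\<forall>s. s \<noteq> 0 \<longrightarrow> f (c s) * s ^ m = poly p s" "\<forall>s. s \<noteq> 0 \<longrightarrow> g (c s) * s ^ m' = poly p' s" by blast
    then have "(f + g) (c s) * s ^ (m + m') = poly (p * [:0, 1:] ^ m' + p' * [:0, 1:] ^ m) s" if "s \<noteq> 0" for s
    proof -
      have "(f + g) (c s) * s ^ (m + m') = (f (c s) * s ^ m) * s ^ m' + (g (c s) * s ^ m') * s ^ m"
        by (simp add: algebra_simps power_add)
      with that \<open>\<forall>s. s \<noteq> 0 \<longrightarrow> f (c s) * s ^ m = poly p s\<close> \<open>\<forall>s. s \<noteq> 0 \<longrightarrow> g (c s) * s ^ m' = poly p' s\<close>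
      show ?thesis by simp
    qed
    then show ?case by blast
  next
    case (mult f g)
    then obtain m p m' p' where
      *: "\<forall>s. s \<noteq> 0 \<longrightarrow> f (c s) * s ^ m = poly p s" "\<forall>s. s \<noteq> 0 \<longrightarrow> g (c s) * s ^ m' = poly p' s" by blast
    have "(f * g) (c s) * s ^ (m + m') = poly (p * p') s" if "s \<noteq> 0" for s
    proof -
      have "(f * g) (c s) * s ^ (m + m') = (f (c s) * s ^ m) * (g (c s) * s ^ m')"
        by (simp add: power_add)
      with * that show ?thesis by simp
    qed
    then show ?case by blast
  qed
qed

lemma character_lattice_simps:
  "carrier (character_lattice 6 max_torus) = {\<chi> \<in> regular_functions 6 max_torus. (\<forall>s\<in>max_torus. \<chi> s \<noteq> 0) \<and>
        (\<forall>s\<in>max_torus. \<forall>t\<in>max_torus. \<chi> (s * t) = \<chi> s * \<chi> t)}"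
  "monoid.mult (character_lattice 6 max_torus) = (*)"
  "\<one>\<^bsub>character_lattice 6 max_torus\<^esub> = chr 0 0"
  by (simp_all add: character_lattice_def chr_one)

text \<open>
  A character restricts on each coordinate axis to a Laurent polynomial without zeros, hence to a
  power of the coordinate; multiplicativity recombines the two axes.
\<close>

lemma carrier_character_lattice:
  "carrier (character_lattice 6 (max_torus :: 'k::alg_closed_field mat set)) = {chr i j | i j. True}"
proof (rule subset_antisym; rule subsetI)
  fix \<chi> :: "'k mat \<Rightarrow> 'k" assume "\<chi> \<in> {chr i j | i j. True}"
  then obtain i j where \<chi>: "\<chi> = chr i j" by blast
  show "\<chi> \<in> carrier (character_lattice 6 max_torus)"
    unfolding character_lattice_simps \<chi>
  proof (intro CollectI conjI ballI reg_chr)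
    fix x y :: "'k mat" assume "x \<in> max_torus" "y \<in> max_torus"
    then obtain s t s' t' where "s \<noteq> 0" "t \<noteq> 0" "x = tor s t" "s' \<noteq> 0" "t' \<noteq> 0" "y = tor s' t'"
      by (auto simp: max_torus_def)
    then show "chr i j (x * y) = chr i j x * chr i j y" "chr i j x \<noteq> 0"
      by (simp_all add: chr_tor tor_mult power_int_mult_distrib)
  qed
next
  fix \<chi> :: "'k mat \<Rightarrow> 'k" assume "\<chi> \<in> carrier (character_lattice 6 max_torus)"
  then have reg: "\<chi> \<in> regular_functions 6 max_torus"
    and nz: "\<And>s t. s \<noteq> 0 \<Longrightarrow> t \<noteq> 0 \<Longrightarrow> \<chi> (tor s t) \<noteq> 0"
    and mult: "\<And>s t s' t'. s \<noteq> 0 \<Longrightarrow> t \<noteq> 0 \<Longrightarrow> s' \<noteq> 0 \<Longrightarrow> t' \<noteq> 0 \<Longrightarrow> \<chi> (tor (s * s') (t * t')) = \<chi> (tor s t) * \<chi> (tor s' t')"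
    unfolding character_lattice_simps by (blast, metis (mono_tags, lifting) mem_Collect_eq tor_in,
      metis (mono_tags, lifting) mem_Collect_eq tor_in tor_mult)
  have one: "\<chi> (tor 1 1) = 1" using mult[of 1 1 1 1] nz[of 1 1] by simp
  have *: "\<exists>i. \<forall>s. s \<noteq> 0 \<longrightarrow> \<chi> (c s) = s powi i" if c: "c = (\<lambda>s. tor s 1) \<or> c = tor 1" for c
  proof -
    obtain m p where mp: "\<forall>s. s \<noteq> 0 \<longrightarrow> \<chi> (c s) * s ^ m = poly p s"
      using torus_curve_laurent[OF reg c] by blast
    show ?thesis
    proof (rule nonvanishing_laurent_is_monomial)
      show "\<chi> (c s) * s ^ m = poly p s" if "s \<noteq> 0" for s using mp that by blast
      show "\<chi> (c s) \<noteq> 0" if "s \<noteq> 0" for s using c nz that by auto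
      show "\<chi> (c 1) = 1" using c one by auto
    qed
  qed
  obtain i j where ij: "\<And>s. s \<noteq> 0 \<Longrightarrow> \<chi> (tor s 1) = s powi i" "\<And>t. t \<noteq> 0 \<Longrightarrow> \<chi> (tor 1 t) = t powi j"
    using *[of "\<lambda>s. tor s 1"] *[of "tor 1"] by blast
  have "\<chi> = chr i j"
  proof (rule eq_on_max_torus)
    fix s t :: 'k assume "s \<noteq> 0" "t \<noteq> 0"
    then show "\<chi> (tor s t) = chr i j (tor s t)" using mult[of s 1 1 t] by (simp add: ij chr_tor)
  qed (simp_all add: fun_on_chr regular_fun_on[OF reg])
  then show "\<chi> \<in> {chr i j | i j. True}" by blast
qed

lemma group_character_lattice: "group (character_lattice 6 (max_torus :: 'k::alg_closed_field mat set))"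
proof (rule groupI)
  fix x :: "'k mat \<Rightarrow> 'k" assume "x \<in> carrier (character_lattice 6 max_torus)"
  then obtain i j where x: "x = chr i j" unfolding carrier_character_lattice by blast
  show "\<exists>y\<in>carrier (character_lattice 6 max_torus). y \<otimes>\<^bsub>character_lattice 6 max_torus\<^esub> x = \<one>\<^bsub>character_lattice 6 max_torus\<^esub>"
    unfolding carrier_character_lattice
    by (rule bexI[of _ "chr (- i) (- j)"]) (auto simp: character_lattice_simps(2,3) chr_mult x)
qed (auto simp: carrier_character_lattice character_lattice_simps(2,3) chr_mult simp del: times_fun_apply,
  auto simp: add.assoc)

section \<open>Roots\<close>

text \<open>
  The tangent vector at the identity of a curve \<open>c\<close>, as a point derivation. An algebraic
  linear coefficient replaces the limit, and the value off \<open>k[G]\<close> is the one that \<open>lie_algebra\<close> asks for.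
\<close>

definition curve_deriv :: "nat \<Rightarrow> 'k::field mat set \<Rightarrow> ('k \<Rightarrow> 'k mat) \<Rightarrow> ('k mat \<Rightarrow> 'k) \<Rightarrow> 'k" where
  "curve_deriv n G c f = (if f \<in> regular_functions n G then poly.coeff (THE p. \<forall>s. f (c s) = poly p s) 1 else 0)"

lemma curve_deriv_eq:
  fixes c :: "'k::alg_closed_field \<Rightarrow> 'k mat"
  assumes "f \<in> regular_functions n G" "\<And>s. f (c s) = poly p s"
  shows "curve_deriv n G c f = poly.coeff p 1"
proof -
  have "(THE p. \<forall>s. f (c s) = poly p s) = p"
    by (rule the_equality) (use assms(2) poly_fun_eqD[of "{}"] in auto)
  with assms(1) show ?thesis by (simp add: curve_deriv_def)
qed

lemma curve_poly:
  assumes "poly_curve n c" "\<And>s. c s \<in> G" "f \<in> regular_functions n G"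
  shows "\<exists>p. \<forall>s. f (c s) = poly p s"
  using poly_fun_regular[OF assms(3,1,2)] unfolding poly_fun_def by blast

lemma curve_deriv_lie_algebra:
  fixes c :: "'k::alg_closed_field \<Rightarrow> 'k mat"
  assumes c: "poly_curve n c" "\<And>s. c s \<in> G" and c0: "c 0 = 1\<^sub>m n"
  shows "curve_deriv n G c \<in> lie_algebra n G"
  unfolding lie_algebra_def
proof (intro CollectI conjI ballI allI impI)
  fix f h assume fh: "f \<in> regular_functions n G" "h \<in> regular_functions n G"
  obtain p where p: "\<And>s. f (c s) = poly p s" using curve_poly[OF c fh(1)] by blast
  obtain q where q: "\<And>s. h (c s) = poly q s" using curve_poly[OF c fh(2)] by blast
  have D: "curve_deriv n G c f = poly.coeff p 1" "curve_deriv n G c h = poly.coeff q 1"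
    using curve_deriv_eq fh p q by blast+
  show "curve_deriv n G c (f + h) = curve_deriv n G c f + curve_deriv n G c h"
    using curve_deriv_eq[OF reg_plus[OF fh], of c "p + q"] p q by (simp add: D)
  have "f (1\<^sub>m n) = poly.coeff p 0" "h (1\<^sub>m n) = poly.coeff q 0"
    using p[of 0] q[of 0] by (simp_all add: c0 poly_0_coeff_0)
  moreover have "poly.coeff (p * q) 1 = poly.coeff p 1 * poly.coeff q 0 + poly.coeff p 0 * poly.coeff q 1"
    by (simp add: coeff_mult)
  ultimately show "curve_deriv n G c (f * h) = curve_deriv n G c f * h \<one>\<^bsub>GL n\<^esub> + f \<one>\<^bsub>GL n\<^esub> * curve_deriv n G c h"
    using curve_deriv_eq[OF reg_times[OF fh], of c "p * q"] p q by (simp add: D)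
next
  fix a f assume f: "f \<in> regular_functions n G"
  obtain p where p: "\<And>s. f (c s) = poly p s" using curve_poly[OF c f] by blast
  show "curve_deriv n G c (fscale a f) = a * curve_deriv n G c f"
    using curve_deriv_eq[OF reg_fscale[OF f, of a], of c "Polynomial.smult a p"] curve_deriv_eq[of f n G c p] f p
    by (simp add: fscale_def)
qed (simp add: curve_deriv_def)

text \<open>
  The linear coefficient of \<open>p(a s)\<close> is \<open>a\<close> times that of \<open>p(s)\<close>, whatever the characteristic.
\<close>

lemma Ad_curve_deriv:
  fixes c :: "'k::alg_closed_field \<Rightarrow> 'k mat"
  assumes G: "subgroup G (GL n)" and c: "poly_curve n c" "\<And>s. c s \<in> G"
    and g: "g \<in> G" "\<And>s. conj_by n g (c s) = c (a * s)"
  shows "Ad n G g (curve_deriv n G c) = fscale a (curve_deriv n G c)"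
proof
  fix f :: "'k mat \<Rightarrow> 'k"
  show "Ad n G g (curve_deriv n G c) f = fscale a (curve_deriv n G c) f"
  proof (cases "f \<in> regular_functions n G")
    case True
    obtain p where p: "\<And>s. f (c s) = poly p s" using curve_poly[OF c True] by blast
    let ?f = "fun_on G (\<lambda>x. f (conj_by n g x))"
    have Gsub: "G \<subseteq> carrier (GL n)" by (rule subgroup.subset[OF G])
    have "?f \<in> regular_functions n G"
      using reg_conj_by[OF Gsub _ conj_by_closed[OF G g(1)] True] g(1) Gsub by blast
    moreover have "?f (c s) = poly (pcompose p [:0, a:]) s" for s
      using c(2) g(2) p by (simp add: fun_on_apply poly_pcompose mult.commute)
    ultimately have "curve_deriv n G c ?f = poly.coeff (pcompose p [:0, a:]) 1" by (rule curve_deriv_eq)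
    also have "\<dots> = a * curve_deriv n G c f"
      using curve_deriv_eq[of f n G c p] True p by (simp add: coeff_pcompose_linear)
    finally show ?thesis using True by (simp add: Ad_def fun_on_apply fscale_def)
  qed (simp add: Ad_def fun_on_def fscale_def curve_deriv_def)
qed

text \<open>
  The torus scales the transvections of each factor by the corresponding coordinate, so the
  velocity of this one-parameter group is a root vector.
\<close>

lemma root_chr:
  fixes e :: bool
  defines "\<alpha> \<equiv> (if e then chr 1 0 else chr 0 1) :: 'k::alg_closed_field mat \<Rightarrow> 'k"
  shows "\<alpha> \<in> roots 6 pgl2_sq max_torus"
proof -
  let ?c = "\<lambda>s :: 'k. emb_at e (up s) sl_one"
  let ?\<delta> = "curve_deriv 6 pgl2_sq ?c"
  have c: "poly_curve 6 ?c" using poly_curve_emb_at[of up sl_one sl_one e] by simp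
  have cG: "?c s \<in> pgl2_sq" for s by simp
  have c0: "?c 0 = 1\<^sub>m 6" using emb_at_simps(2)[of e] by (simp add: up_def sl_one_def)
  have \<delta>: "?\<delta> \<in> lie_algebra 6 pgl2_sq" by (rule curve_deriv_lie_algebra[OF c cG c0])
  define k where "k = (if e then 0 else 3 :: nat)"
  let ?f = "fun_on pgl2_sq (\<lambda>A :: 'k mat. A $$ (k, Suc k))"
  have "?f \<in> regular_functions 6 pgl2_sq" by (rule reg_entry) (simp_all add: k_def)
  moreover have "?f (?c s) = poly [:0, 1:] s" for s
    unfolding fun_on_apply[OF cG]
    by (cases e) (simp_all add: k_def emb_at_def emb_index up_def sym2_index[unfolded One_nat_def] del: sym2.simps)
  ultimately have "?\<delta> ?f = poly.coeff [:0, 1:] 1" by (rule curve_deriv_eq)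
  then have nz: "?\<delta> \<noteq> 0" by (metis coeff_pCons_Suc One_nat_def coeff_pCons_0 zero_fun_apply zero_neq_one)
  have Ad: "Ad 6 pgl2_sq t ?\<delta> = fscale (\<alpha> t) ?\<delta>" if "t \<in> max_torus" for t
  proof -
    obtain a b where ab: "a \<noteq> 0" "b \<noteq> 0" "t = emb (dg a) (dg b)" using \<open>t \<in> max_torus\<close> unfolding max_torus_eq by blast
    then have t: "t = tor (a * a) (b * b)" by (simp add: emb_dg)
    have dg: "sl_mult (sl_mult (dg x) (up s)) (sl_inv (dg x)) = up (x * x * s)" if "x \<noteq> 0" for x s :: 'k
      using that by (simp add: dg_def up_def mult_ac)
    have one: "sl_mult (dg x) (sl_inv (dg x)) = sl_one" if "x \<noteq> 0" for x :: 'k using that by simp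
    have \<alpha>: "\<alpha> t = (if e then a * a else b * b)" using ab(1,2) by (simp add: t \<alpha>_def chr_tor)
    have "conj_by 6 t (?c s) = ?c (\<alpha> t * s)" for s
      unfolding \<alpha> unfolding ab(3) using ab(1,2)
      by (cases e) (simp_all add: emb_at_def emb_conj dg one del: emb_one)
    moreover have "t \<in> pgl2_sq" using that max_torus_sub by blast
    ultimately show ?thesis by (intro Ad_curve_deriv[OF subgroup_pgl2_sq c cG])
  qed
  obtain u :: 'k where u: "u \<noteq> 0" "u * u \<noteq> 1" using ex_square_neq_1 by blast
  have "\<alpha> (tor (u * u) (u * u)) \<noteq> chr 0 0 (tor (u * u) (u * u))"
    using u by (simp add: \<alpha>_def chr_tor)
  then have "\<alpha> \<noteq> \<one>\<^bsub>character_lattice 6 max_torus\<^esub>" unfolding character_lattice_simps by metis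
  moreover have "\<alpha> \<in> carrier (character_lattice 6 max_torus)"
    unfolding carrier_character_lattice \<alpha>_def by auto
  ultimately show ?thesis using \<delta> nz Ad unfolding roots_def by blast
qed

lemma adjoint_pgl2_sq: "adjoint_group 6 (pgl2_sq :: 'k::alg_closed_field mat set)"
  unfolding adjoint_group_def
proof (intro exI conjI)
  show "maximal_torus 6 (pgl2_sq :: 'k mat set) max_torus" by (rule maximal_torus_max_torus)
  let ?L = "character_lattice 6 (max_torus :: 'k mat set)" and ?R = "roots 6 (pgl2_sq :: 'k mat set) max_torus"
  interpret L: group ?L by (rule group_character_lattice)
  have gen: "x * y \<in> generate ?L ?R" if "x \<in> generate ?L ?R" "y \<in> generate ?L ?R" for x y
    using generate.eng[OF that] unfolding character_lattice_simps .
  have carr: "chr i j \<in> carrier ?L" for i j unfolding carrier_character_lattice by blast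
  have inv: "inv\<^bsub>?L\<^esub> (chr i j) = chr (- i) (- j)" for i j
    by (rule L.inv_equality) (simp_all only: carr character_lattice_simps(2,3) chr_mult, simp)
  have pow: "chr (m * i) (m * j) \<in> generate ?L ?R" if r: "chr i j \<in> ?R" for m i j
  proof (induction m rule: int_induct[of _ 0])
    case base
    show ?case using generate.one[of ?L ?R] unfolding character_lattice_simps by simp
  next
    case (step1 m)
    have "chr (m * i) (m * j) * chr i j \<in> generate ?L ?R"
      using gen[OF step1(2) generate.incl[OF r]] .
    then show ?case by (simp add: chr_mult algebra_simps)
  next
    case (step2 m)
    have "chr (m * i) (m * j) * chr (- i) (- j) \<in> generate ?L ?R"
      using gen[OF step2(2) generate.inv[OF r]] unfolding inv .
    then show ?case by (simp add: chr_mult algebra_simps)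
  qed
  have "chr i j \<in> generate ?L ?R" for i j
    using gen[OF pow[of 1 0 i] pow[of 0 1 j]] root_chr[of True] root_chr[of False]
    by (simp add: chr_mult)
  then show "generate ?L ?R = carrier ?L"
    using L.generate_incl[of ?R] carrier_character_lattice[where 'k = 'k]
    by (auto simp: roots_def)
qed

section \<open>An asymmetric class function\<close>

definition swap_mat :: "'k::field mat" where
  "swap_mat = four_block_mat (0\<^sub>m 3 3) (1\<^sub>m 3) (1\<^sub>m 3) (0\<^sub>m 3 3)"

lemma swap_mat_GL:
  "(swap_mat :: 'k::field mat) \<in> carrier (GL 6)" "inv\<^bsub>GL 6\<^esub> swap_mat = (swap_mat :: 'k mat)"
proof -
  have c: "(swap_mat :: 'k mat) \<in> carrier_mat 6 6"
    using four_block_carrier_mat[of "0\<^sub>m 3 3 :: 'k mat" 3 3 "0\<^sub>m 3 3" 3 3 "1\<^sub>m 3" "1\<^sub>m 3"] by (simp add: swap_mat_def)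
  have m: "swap_mat * swap_mat = (1\<^sub>m 6 :: 'k mat)"
    unfolding swap_mat_def by (subst mult_four_block_mat[of _ 3 3 _ 3 _ 3 _ _ 3 _ 3]) auto
  show "(swap_mat :: 'k mat) \<in> carrier (GL 6)" "inv\<^bsub>GL 6\<^esub> swap_mat = (swap_mat :: 'k mat)"
    using GL_I[OF c c m m] by auto
qed

lemma conj_swap: "conj_by 6 swap_mat (emb x y) = emb y x"
proof -
  have "swap_mat * emb x y * swap_mat = emb y x"
    unfolding swap_mat_def emb_def
    by (subst mult_four_block_mat[of _ 3 3 _ 3 _ 3 _ _ 3 _ 3], simp_all,
        subst mult_four_block_mat[of _ 3 3 _ 3 _ 3 _ _ 3 _ 3], simp_all)
  then show ?thesis by (simp add: conj_by_def swap_mat_GL)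
qed

definition block_trace :: "'k::field mat \<Rightarrow> 'k" where
  "block_trace = fun_on pgl2_sq (\<lambda>A. A $$ (0, 0) + A $$ (1, 1) + A $$ (2, 2))"

fun sl_trace :: "'k::field quad \<Rightarrow> 'k" where "sl_trace (Q a b c d) = a + d"

lemma sl_trace_conj: "g \<in> SL2 \<Longrightarrow> sl_trace (sl_mult (sl_mult g x) (sl_inv g)) = sl_trace x"
proof (cases g; cases x)
  fix a b c d p q r s assume *: "g \<in> SL2" "g = Q a b c d" "x = Q p q r s"
  have "sl_trace (sl_mult (sl_mult g x) (sl_inv g)) = (a * d - b * c) * (p + s)"
    by (simp add: *(2,3) algebra_simps)
  with * show ?thesis by (simp add: SL2_def)
qed

text \<open>
  The trace of the symmetric square in terms of the trace on \<open>SL\<^sub>2\<close>; it is visibly a class function.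
\<close>

lemma block_trace_emb:
  assumes "x \<in> SL2" "y \<in> SL2" shows "block_trace (emb x y) = sl_trace x ^ 2 - 1"
proof -
  obtain a b c d where x: "x = Q a b c d" by (cases x)
  have "b * c = a * d - 1" using assms(1) by (simp add: x SL2_def algebra_simps)
  then have "sym2 x $$ (0, 0) + sym2 x $$ (1, 1) + sym2 x $$ (2, 2) = (a + d) ^ 2 - 1"
    unfolding x sym2_index by (simp add: power2_eq_square algebra_simps)
  then show ?thesis using assms by (simp add: block_trace_def fun_on_apply emb_index x del: sym2.simps)
qed

lemma block_trace_class_function: "block_trace \<in> class_functions 6 pgl2_sq"
  unfolding class_functions_def
proof (intro CollectI conjI ballI)
  show "(block_trace :: 'a mat \<Rightarrow> 'a) \<in> regular_functions 6 pgl2_sq"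
    unfolding block_trace_def by (intro reg_add reg_entry) simp_all
  fix g x :: "'a mat" assume "g \<in> pgl2_sq" "x \<in> pgl2_sq"
  then obtain a b c d where *: "a \<in> SL2" "b \<in> SL2" "g = emb a b" "c \<in> SL2" "d \<in> SL2" "x = emb c d"
    by (auto simp: pgl2_sq_def)
  then show "block_trace (conj_by 6 g x) = block_trace x"
    by (simp add: emb_conj block_trace_emb sl_trace_conj)
qed

theorem mainTheorem12:
  shows "\<exists>n (G :: 'k::alg_closed_field mat set).
    linear_algebraic_group n G \<and> connectedin (zariski n) G \<and>
    semisimple_group n G \<and> adjoint_group n G \<and>
    \<not> class_functions n G \<subseteq> gen_algebra G (char_coeffs G (lie_algebra n G) (Ad n G))"
proof (intro exI conjI)
  show "linear_algebraic_group 6 (pgl2_sq :: 'k mat set)"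
    unfolding linear_algebraic_group_def using subgroup_pgl2_sq closedin_pgl2_sq by blast
  show "connectedin (zariski 6) (pgl2_sq :: 'k mat set)" by (rule connectedin_pgl2_sq)
  show "semisimple_group 6 (pgl2_sq :: 'k mat set)" by (rule semisimple_pgl2_sq)
  show "adjoint_group 6 (pgl2_sq :: 'k mat set)" by (rule adjoint_pgl2_sq)
  let ?A = "gen_algebra pgl2_sq (char_coeffs pgl2_sq (lie_algebra 6 pgl2_sq) (Ad 6 (pgl2_sq :: 'k mat set)))"
  have swapG: "conj_by 6 swap_mat x \<in> pgl2_sq" if "x \<in> pgl2_sq" for x :: "'k mat"
    using that unfolding pgl2_sq_def by (force simp: conj_swap)
  show "\<not> class_functions 6 pgl2_sq \<subseteq> ?A"
  proof
    assume "class_functions 6 pgl2_sq \<subseteq> ?A"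
    then have "block_trace \<in> ?A" using block_trace_class_function by blast
    then have inv: "block_trace (conj_by 6 swap_mat x) = block_trace x" if "x \<in> pgl2_sq" for x :: "'k mat"
      using char_coeffs_normaliser_invariant[OF subgroup_pgl2_sq swap_mat_GL(1)] swapG that
      unfolding swap_mat_GL(2) by blast
    \<comment> \<open>The pair of an element of trace \<open>t\<close> and the identity has block trace \<open>t\<^sup>2 - 1\<close>, its swap \<open>2\<^sup>2 - 1\<close>.
      The two values \<open>t = 0\<close> and \<open>t = 1\<close> cannot both satisfy the resulting equation, whatever the
      characteristic.\<close>
    have "t ^ 2 = 4" for t :: 'k
    proof -
      have x: "Q t 1 (- 1) 0 \<in> SL2" by (simp add: SL2_def)
      from inv[of "emb (Q t 1 (- 1) 0) sl_one"] x show ?thesis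
        by (simp add: conj_swap block_trace_emb) (simp add: sl_one_def)
    qed
    from this[of 0] this[of 1] show False by simp
  qed
qed

end
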